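(* Let $\lambda=(\xi_1^{m_1},\dots,\xi_k^{m_k})$ be an arbitrary partition, where $\xi_1>\dots>\xi_k>0$ are its distinct components and $m_i\ge 1$ their multiplicities, and let $\mathfrak{C}_\lambda=\{\alpha_1,\dots,\alpha_{k+1}\}$ be the inner corner set of the Young diagram $\lambda$. Then the following identity of Schur symmetric functions holds: $$s_\lambda\, s_\lambda=\sum_{\alpha\in\mathfrak{C}_\lambda} s_{\lambda^+_-(\alpha)}\, s_{\lambda^-_+(\alpha)}.$$
   Context: Schur symmetric functions $s_\lambda$ are elements of the ring $\Lambda$ of symmetric functions over $\mathbb{Z}$ in countably many indeterminates. Set $\xi_{k+1}=0$, $y_0=0$, $y_i=m_i+y_{i-1}$ for $1\le i\le k$. In the coordinate system on the Young diagram with origin at the top left corner, $x$-axis directed to the right and $y$-axis directed downwards (boxes of size $1\times1$), the inner corner set is $\mathfrak{C}_\lambda=\{\alpha_i=(\xi_i,y_{i-1})\mid 1\le i\le k+1\}$. A diagram is determined by its inner corner set. The horizontal shift of the corner $\alpha_i=(\xi_i,y_{i-1})$ (with $\xi_i\ne0$) by $\pm1$ means increasing or decreasing the component $\xi_i$ by $1$ (keeping its multiplicity $m_i$, rows which become of equal length being united). The vertical shift of $\alpha_i$ (with $y_{i-1}\neq 0$) by $-1$ (resp. $+1$) decreases (resp. increases) the multiplicity $m_{i-1}$ by $1$ and increases (resp. decreases) the multiplicity $m_i$ by $1$; components whose multiplicity becomes $0$ disappear. For an inner corner $\alpha_i$, the diagram $\lambda^+_-(\alpha_i)$ is obtained by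 shifting horizontally by $+1$ all inner corners $\alpha_j$ with $j<i$ and vertically by $-1$ all inner corners $\alpha_j$ with $j>i$, keeping $\alpha_i$ unchanged; the diagram $\lambda^-_+(\alpha_i)$ is obtained by shifting horizontally by $-1$ all $\alpha_j$ with $j<i$ and vertically by $+1$ all $\alpha_j$ with $j>i$, keeping $\alpha_i$ unchanged. Explicitly, for $1\le i\le k$, $$\lambda^+_-(\alpha_i)=((\xi_1+1)^{m_1},\dots,(\xi_{i-1}+1)^{m_{i-1}},\xi_i^{m_i-1},\xi_{i+1}^{m_{i+1}},\dots,\xi_k^{m_k}),$$ $$\lambda^-_+(\alpha_i)=((\xi_1-1)^{m_1},\dots,(\xi_{i-1}-1)^{m_{i-1}},\xi_i^{m_i+1},\xi_{i+1}^{m_{i+1}},\dots,\xi_k^{m_k}),$$ and $\lambda^+_-(\alpha_{k+1})=((\xi_1+1)^{m_1},\dots,(\xi_k+1)^{m_k})$, $\lambda^-_+(\alpha_{k+1})=((\xi_1-1)^{m_1},\dots,(\xi_k-1)^{m_k})$ (zero components are dropped). For example, for $\lambda=(6,5,2^2,1)$ and $\alpha_3=(2,2)$: $\lambda^+_-(\alpha_3)=(7,6,2,1)$ and $\lambda^-_+(\alpha_3)=(5,4,2^3,1)$. *)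

theory Defs
  imports Complex_Main "HOL-Library.Poly_Mapping" "HOL-Library.FuncSet"
begin

section \<open>Formal power series in countably many variables\<close>

text \<open>
  A monomial in the variables \<open>x\<^sub>0, x\<^sub>1, x\<^sub>2, \<dots>\<close> is its finitely supported exponent
  vector, of type \<open>nat \<Rightarrow>\<^sub>0 nat\<close>; a power series is an arbitrary function from
  monomials to coefficients. The ring \<open>\<Lambda>\<close> of symmetric functions over the integers is the
  subring of \<open>int mfps\<close> consisting of the series that are of bounded degree and
  invariant under permutations of the variables.
\<close>

typedef 'a mfps = "UNIV :: ((nat \<Rightarrow>\<^sub>0 nat) \<Rightarrow> 'a) set"
  morphisms mcoeff Abs_mfps
  by simp

lemma mcoeff_Abs [simp]: "mcoeff (Abs_mfps f) = f"
  by (simp add: Abs_mfps_inverse)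

lemma Abs_mcoeff [simp]: "Abs_mfps (mcoeff f) = f"
  by (simp add: mcoeff_inverse)

lemma mfps_eqI: "(\<And>\<mu>. mcoeff f \<mu> = mcoeff g \<mu>) \<Longrightarrow> f = g"
  by (metis mcoeff_inject ext)

definition splits :: "(nat \<Rightarrow>\<^sub>0 nat) \<Rightarrow> ((nat \<Rightarrow>\<^sub>0 nat) \<times> (nat \<Rightarrow>\<^sub>0 nat)) set" where
  "splits \<mu> = {(\<alpha>, \<beta>). \<alpha> + \<beta> = \<mu>}"

lemma finite_splits [simp, intro]: "finite (splits \<mu>)"
proof -
  define M where "M = Max (insert 0 (range (Poly_Mapping.lookup \<mu>)))"
  have M: "Poly_Mapping.lookup \<mu> v \<le> M" for v
  proof -
    have "range (Poly_Mapping.lookup \<mu>) \<subseteq> insert 0 (Poly_Mapping.lookup \<mu> ` Poly_Mapping.keys \<mu>)"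
      by (auto simp: in_keys_iff)
    then have "finite (range (Poly_Mapping.lookup \<mu>))"
      using finite_keys finite_subset by blast
    then show ?thesis unfolding M_def by (intro Max_ge) auto
  qed
  let ?F = "{f. \<forall>v. (v \<in> Poly_Mapping.keys \<mu> \<longrightarrow> f v \<in> {..M}) \<and> (v \<notin> Poly_Mapping.keys \<mu> \<longrightarrow> f v = (0::nat))}"
  have fin: "finite ?F"
    by (intro finite_set_of_finite_funs) auto
  have le: "Poly_Mapping.lookup \<alpha> v \<le> Poly_Mapping.lookup \<mu> v" if "\<alpha> + \<beta> = \<mu>" for \<alpha> \<beta> v
    using that by (auto simp: lookup_add)
  have sub: "Poly_Mapping.lookup \<alpha> \<in> ?F" if "\<alpha> + \<beta> = \<mu>" for \<alpha> \<beta>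
  proof -
    have "Poly_Mapping.lookup \<alpha> v \<le> M" for v using le[OF that] M order_trans by blast
    moreover have "Poly_Mapping.lookup \<alpha> v = 0" if "v \<notin> Poly_Mapping.keys \<mu>" for v
      using le[OF \<open>\<alpha> + \<beta> = \<mu>\<close>, of v] that by (simp add: in_keys_iff)
    ultimately show ?thesis by auto
  qed
  have "inj_on (\<lambda>p. Poly_Mapping.lookup (fst p)) (splits \<mu>)"
    by (rule inj_onI) (auto simp: splits_def lookup_inject)
  moreover have "(\<lambda>p. Poly_Mapping.lookup (fst p)) ` splits \<mu> \<subseteq> ?F"
    using sub by (fastforce simp: splits_def)
  ultimately show ?thesis
    using fin by (meson finite_imageD finite_subset)
qed

instantiation mfps :: (comm_ring_1) comm_ring_1
begin

definition "0 = Abs_mfps (\<lambda>\<mu>. 0)"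
definition "1 = Abs_mfps (\<lambda>\<mu>. if \<mu> = 0 then 1 else 0)"
definition "f + g = Abs_mfps (\<lambda>\<mu>. mcoeff f \<mu> + mcoeff g \<mu>)"
definition "f - g = Abs_mfps (\<lambda>\<mu>. mcoeff f \<mu> - mcoeff g \<mu>)"
definition "- f = Abs_mfps (\<lambda>\<mu>. - mcoeff f \<mu>)"
definition "f * g = Abs_mfps (\<lambda>\<mu>. \<Sum>(\<alpha>, \<beta>)\<in>splits \<mu>. mcoeff f \<alpha> * mcoeff g \<beta>)"

instance
proof
  fix f g h :: "'a mfps"
  show "f + g + h = f + (g + h)" "f + g = g + f" "0 + f = f" "- f + f = 0" "f - g = f + - g"
    by (simp_all add: plus_mfps_def minus_mfps_def uminus_mfps_def zero_mfps_def algebra_simps)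
  show "(f + g) * h = f * h + g * h"
    by (simp add: plus_mfps_def times_mfps_def algebra_simps sum.distrib split_def)
  show "(0 :: 'a mfps) \<noteq> 1"
  proof
    assume "(0 :: 'a mfps) = 1"
    then have "mcoeff (0 :: 'a mfps) 0 = mcoeff 1 0" by simp
    then show False by (simp add: zero_mfps_def one_mfps_def)
  qed
  show "f * g = g * f"
  proof (rule mfps_eqI)
    fix \<mu>
    show "mcoeff (f * g) \<mu> = mcoeff (g * f) \<mu>"
      unfolding times_mfps_def mcoeff_Abs
      by (rule sum.reindex_bij_witness[of _ prod.swap prod.swap])
        (auto simp: splits_def add.commute mult.commute)
  qed
  show "1 * f = f"
  proof (rule mfps_eqI)
    fix \<mu>
    have "mcoeff (1 * f) \<mu> =
        (\<Sum>p\<in>splits \<mu>. if p = (0, \<mu>) then mcoeff f \<mu> else 0)"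
      unfolding times_mfps_def mcoeff_Abs
      by (rule sum.cong) (auto simp: splits_def one_mfps_def split: if_splits)
    also have "\<dots> = mcoeff f \<mu>"
      by (subst sum.delta[OF finite_splits]) (simp add: splits_def)
    finally show "mcoeff (1 * f) \<mu> = mcoeff f \<mu>" .
  qed
  show "f * g * h = f * (g * h)"
  proof (rule mfps_eqI)
    fix \<mu>
    let ?t = "\<lambda>a b c. mcoeff f a * mcoeff g b * mcoeff h c"
    have "mcoeff (f * g * h) \<mu> =
        (\<Sum>p\<in>splits \<mu>. \<Sum>q\<in>splits (fst p). ?t (fst q) (snd q) (snd p))"
      by (simp add: times_mfps_def split_def sum_distrib_right)
    also have "\<dots> = (\<Sum>(p, q)\<in>(SIGMA p:splits \<mu>. splits (fst p)). ?t (fst q) (snd q) (snd p))"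
      by (rule sum.Sigma) auto
    also have "\<dots> = (\<Sum>(p, q)\<in>(SIGMA p:splits \<mu>. splits (snd p)). ?t (fst p) (fst q) (snd q))"
      by (rule sum.reindex_bij_witness
            [of _ "\<lambda>(p, q). ((fst p + fst q, snd q), (fst p, fst q))"
                  "\<lambda>(p, q). ((fst q, snd q + snd p), (snd q, snd p))"])
        (auto simp: splits_def add.assoc)
    also have "\<dots> = (\<Sum>p\<in>splits \<mu>. \<Sum>q\<in>splits (snd p). ?t (fst p) (fst q) (snd q))"
      by (rule sum.Sigma[symmetric]) auto
    also have "\<dots> = mcoeff (f * (g * h)) \<mu>"
      by (simp add: times_mfps_def split_def sum_distrib_left mult.assoc)
    finally show "mcoeff (f * g * h) \<mu> = mcoeff (f * (g * h)) \<mu>" .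
  qed
qed

end

section \<open>Schur functions\<close>

text \<open>A partition is the weakly decreasing list of its positive parts.\<close>

definition is_partition :: "nat list \<Rightarrow> bool" where
  "is_partition lam \<longleftrightarrow> sorted_wrt (\<ge>) lam \<and> 0 \<notin> set lam"

text \<open>Cells are pairs (row, column), counted from 0.\<close>

definition diagram :: "nat list \<Rightarrow> (nat \<times> nat) set" where
  "diagram lam = {(r, c). r < length lam \<and> c < lam ! r}"

definition ssyt :: "nat list \<Rightarrow> (nat \<times> nat \<Rightarrow> nat) set" where
  "ssyt lam = {T \<in> diagram lam \<rightarrow>\<^sub>E UNIV.
     (\<forall>r c c'. c < c' \<longrightarrow> (r, c) \<in> diagram lam \<longrightarrow> (r, c') \<in> diagram lam \<longrightarrow> T (r, c) \<le> T (r, c')) \<and>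
     (\<forall>r r' c. r < r' \<longrightarrow> (r, c) \<in> diagram lam \<longrightarrow> (r', c) \<in> diagram lam \<longrightarrow> T (r, c) < T (r', c))}"

definition content :: "nat list \<Rightarrow> (nat \<times> nat \<Rightarrow> nat) \<Rightarrow> nat \<Rightarrow> nat" where
  "content lam T v = card {p \<in> diagram lam. T p = v}"

definition schur :: "nat list \<Rightarrow> int mfps" where
  "schur lam = Abs_mfps (\<lambda>\<mu>. int (card {T \<in> ssyt lam. content lam T = Poly_Mapping.lookup \<mu>}))"

lemma finite_diagram [simp, intro]: "finite (diagram lam)"
proof -
  have "diagram lam = (SIGMA r:{..<length lam}. {..<lam ! r})"
    by (auto simp: diagram_def)
  then show ?thesis by simp
qed

text \<open>The set counted in \<open>schur\<close> is finite, so the cardinality is the true count.\<close>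

lemma finite_ssyt_content: "finite {T \<in> ssyt lam. content lam T = Poly_Mapping.lookup \<mu>}"
proof (rule finite_subset)
  show "{T \<in> ssyt lam. content lam T = Poly_Mapping.lookup \<mu>} \<subseteq> diagram lam \<rightarrow>\<^sub>E Poly_Mapping.keys \<mu>"
  proof
    fix T assume T: "T \<in> {T \<in> ssyt lam. content lam T = Poly_Mapping.lookup \<mu>}"
    then have E: "T \<in> diagram lam \<rightarrow>\<^sub>E UNIV" and C: "content lam T = Poly_Mapping.lookup \<mu>"
      by (auto simp: ssyt_def)
    have "T p \<in> Poly_Mapping.keys \<mu>" if "p \<in> diagram lam" for p
    proof -
      have "content lam T (T p) \<noteq> 0"
        using that by (cases p) (auto simp: content_def)
      then show ?thesis by (simp add: C in_keys_iff)
    qed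
    then show "T \<in> diagram lam \<rightarrow>\<^sub>E Poly_Mapping.keys \<mu>"
      using E by (auto simp: PiE_def)
  qed
  show "finite (diagram lam \<rightarrow>\<^sub>E Poly_Mapping.keys \<mu>)"
    by (intro finite_PiE) auto
qed

section \<open>Inner corners and their shifts\<close>

text \<open>
  The form \<open>(\<xi>\<^sub>1\<^bsup>m\<^sub>1\<^esup>, \<dots>, \<xi>\<^sub>k\<^bsup>m\<^sub>k\<^esup>)\<close> of a partition, with indices from 1. On a weakly
  decreasing list \<open>remdups\<close> yields the distinct parts in decreasing order. The values
  at index \<open>k + 1\<close> are 0.
\<close>

definition num_parts :: "nat list \<Rightarrow> nat" where
  "num_parts lam = length (remdups lam)"

definition part :: "nat list \<Rightarrow> nat \<Rightarrow> nat" where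
  "part lam i = (if 1 \<le> i \<and> i \<le> num_parts lam then remdups lam ! (i - 1) else 0)"

definition mult :: "nat list \<Rightarrow> nat \<Rightarrow> nat" where
  "mult lam i = count_list lam (part lam i)"

text \<open>Corners are points \<open>(x, y)\<close>, with \<open>x\<close> directed to the right and \<open>y\<close> downwards.\<close>

definition corner :: "nat list \<Rightarrow> nat \<Rightarrow> nat \<times> nat" where
  "corner lam i = (part lam i, \<Sum>j = 1..<i. mult lam j)"

definition inner_corners :: "nat list \<Rightarrow> (nat \<times> nat) set" where
  "inner_corners lam = corner lam ` {1..num_parts lam + 1}"

definition corner_index :: "nat list \<Rightarrow> nat \<times> nat \<Rightarrow> nat" where
  "corner_index lam \<alpha> = inv_into {1..num_parts lam + 1} (corner lam) \<alpha>"

text \<open>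
  The diagram obtained by shifting, for every \<open>j\<close>, the \<open>j\<close>-th inner corner
  horizontally by \<open>h j\<close> and vertically by \<open>v j\<close>. A vertical shift of the \<open>j\<close>-th corner by
  \<open>d\<close> changes \<open>m\<^sub>j\<^sub>-\<^sub>1\<close> by \<open>d\<close> and \<open>m\<^sub>j\<close> by \<open>-d\<close>, so the new multiplicity of
  the \<open>j\<close>-th component is \<open>m\<^sub>j + v (j + 1) - v j\<close>. Components that become equal are
  united, as the list just repeats them; zero components are dropped.
\<close>

definition shift_corners :: "nat list \<Rightarrow> (nat \<Rightarrow> int) \<Rightarrow> (nat \<Rightarrow> int) \<Rightarrow> nat list" where
  "shift_corners lam h v = filter (\<lambda>x. x \<noteq> 0)
     (concat (map (\<lambda>j. replicate (nat (int (mult lam j) + v (j + 1) - v j))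
                                 (nat (int (part lam j) + h j)))
                  [1..<num_parts lam + 1]))"

definition shift_pm :: "nat list \<Rightarrow> nat \<times> nat \<Rightarrow> nat list" where
  "shift_pm lam \<alpha> = shift_corners lam
     (\<lambda>j. if j < corner_index lam \<alpha> then 1 else 0)
     (\<lambda>j. if j > corner_index lam \<alpha> then -1 else 0)"

definition shift_mp :: "nat list \<Rightarrow> nat \<times> nat \<Rightarrow> nat list" where
  "shift_mp lam \<alpha> = shift_corners lam
     (\<lambda>j. if j < corner_index lam \<alpha> then -1 else 0)
     (\<lambda>j. if j > corner_index lam \<alpha> then 1 else 0)"

lemma inj_on_corner:
  assumes "is_partition lam"
  shows "inj_on (corner lam) {1..num_parts lam + 1}"
proof (rule inj_onI)
  fix i j
  assume ij: "i \<in> {1..num_parts lam + 1}" "j \<in> {1..num_parts lam + 1}"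
    and "corner lam i = corner lam j"
  then have eq: "part lam i = part lam j" by (simp add: corner_def)
  have nz: "part lam l \<noteq> 0" if "1 \<le> l" "l \<le> num_parts lam" for l
  proof -
    have "part lam l \<in> set (remdups lam)"
      using that unfolding part_def num_parts_def
      by (auto simp del: set_remdups intro!: nth_mem)
    then show ?thesis using assms unfolding is_partition_def by (metis set_remdups)
  qed
  have z: "part lam (num_parts lam + 1) = 0" by (simp add: part_def)
  show "i = j"
  proof (cases "i \<le> num_parts lam \<and> j \<le> num_parts lam")
    case True
    then have "remdups lam ! (i - 1) = remdups lam ! (j - 1)"
      using eq ij by (simp add: part_def)
    then have "i - 1 = j - 1"
      using True ij by (subst (asm) nth_eq_iff_index_eq) (auto simp: num_parts_def)
    then show ?thesis using ij by (auto simp: Suc_le_eq)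
  next
    case False
    then show ?thesis using eq ij nz z
      by (metis atLeastAtMost_iff le_antisym not_less_eq_eq Suc_eq_plus1)
  qed
qed

lemma corner_index_corner:
  assumes "is_partition lam" "1 \<le> i" "i \<le> num_parts lam + 1"
  shows "corner_index lam (corner lam i) = i"
  unfolding corner_index_def using assms by (intro inv_into_f_f inj_on_corner) auto

lemma shift_pm_corner:
  assumes "is_partition lam" "1 \<le> i" "i \<le> num_parts lam + 1"
  shows "shift_pm lam (corner lam i) = filter (\<lambda>x. x \<noteq> 0)
     (concat (map (\<lambda>j. replicate (if j = i then mult lam j - 1 else mult lam j)
                                 (if j < i then part lam j + 1 else part lam j))
                  [1..<num_parts lam + 1]))"
  unfolding shift_pm_def shift_corners_def corner_index_corner[OF assms]
  by (intro arg_cong[where f = "filter _"] arg_cong[where f = concat] map_cong)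
    (auto simp: nat_diff_distrib' nat_add_distrib)

lemma shift_mp_corner:
  assumes "is_partition lam" "1 \<le> i" "i \<le> num_parts lam + 1"
  shows "shift_mp lam (corner lam i) = filter (\<lambda>x. x \<noteq> 0)
     (concat (map (\<lambda>j. replicate (if j = i then mult lam j + 1 else mult lam j)
                                 (if j < i then part lam j - 1 else part lam j))
                  [1..<num_parts lam + 1]))"
  unfolding shift_mp_def shift_corners_def corner_index_corner[OF assms]
  by (intro arg_cong[where f = "filter _"] arg_cong[where f = concat] map_cong)
    (auto simp: nat_diff_distrib' nat_add_distrib)

lemma inner_corners_example:
  "inner_corners [6,5,2,2,1] = {(6,0), (5,1), (2,2), (1,4), (0,5)}"
  by code_simp

lemma shift_example:
  "shift_pm [6,5,2,2,1] (2,2) = [7,6,2,1]"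
  "shift_mp [6,5,2,2,1] (2,2) = [5,4,2,2,2,1]"
proof -
  have "corner [6,5,2,2,1] 3 = (2,2)" "num_parts [6,5,2,2,1] = 4" "is_partition [6,5,2,2,1]"
    by code_simp+
  then have "corner_index [6,5,2,2,1] (2,2) = 3"
    using corner_index_corner[of "[6,5,2,2,1]" 3] by simp
  then show "shift_pm [6,5,2,2,1] (2,2) = [7,6,2,1]"
    "shift_mp [6,5,2,2,1] (2,2) = [5,4,2,2,2,1]"
    unfolding shift_pm_def shift_mp_def by (simp_all only:) code_simp+
qed

end

theory Submission
  imports Defs "Jordan_Normal_Form.Determinant"
begin

text \<open>
  The identity is a single quadratic Pluecker relation between Jacobi-Trudi determinants.

  Let \<open>\<mu>\<close> have \<open>l\<close> positive rows. The determinant \<open>det (h\<^bsub>\<mu>\<^sub>i - i + j\<^esub>)\<close> is a maximal minor formed by the row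
  vectors \<open>W c = (h\<^bsub>c + j\<^esub>)\<^sub>j\<close> with \<open>c = \<mu>\<^sub>i - i\<close>, and \<open>\<mu>\<close> may be padded with zero rows. Padding with two
  and with one zero row gives two determinants of consecutive sizes that are both \<open>s\<^sub>\<mu>\<close>; the smaller one
  becomes a minor of the larger size by adjoining the unit vector \<open>e\<close>, which removes the first column
  and thereby shifts all indices by one. In the product of the two, exchange \<open>e\<close> in the second factor
  with every row vector \<open>W (\<mu>\<^sub>r - r)\<close> of the first. Since a shift of the index of \<open>W\<close> moves a part to the
  next row or changes it by one, removing row \<open>r\<close> from the first factor yields the
  shape in which the rows above \<open>r\<close> have grown by one and row \<open>r\<close> is deleted, and inserting it into the
  second yields the shape in which the rows above \<open>r\<close> have shrunk by one and row \<open>r\<close> is repeated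
  (\<open>jt_square\<close>). If row \<open>r - 1\<close> is as long as row \<open>r\<close>, the second determinant has two equal rows and vanishes;
  what remains are the rows in which an inner corner lies (\<open>schur_poly_square\<close>).

  The Jacobi-Trudi formula itself (\<open>jacobi_trudi\<close>) is proved for finitely many variables, by
  induction on their number. Removing the entries with the largest value from a tableau leaves a
  tableau whose shape interlaces the original one (\<open>schur_poly_branching\<close>), and the determinants satisfy
  the same recursion (\<open>jt_branching\<close>): subtracting from each row a multiple of the next one turns the
  entries into sums over precisely the interlacing row lengths, and multilinearity does the rest.
  All this takes place in an arbitrary commutative ring. Finally, a coefficient of a series in
  infinitely many variables involves only finitely many of them (\<open>mcoeff_schur_mult\<close>), and the lists
  that describe the shifted diagrams are matched with the row operations above.
\<close>

section \<open>The Pluecker relation\<close>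

abbreviation rdet :: "nat \<Rightarrow> (nat \<Rightarrow> nat \<Rightarrow> 'a) \<Rightarrow> 'a::comm_ring_1" where
  "rdet n R \<equiv> det (mat n n (\<lambda>(i, j). R i j))"

definition insert_row :: "nat \<Rightarrow> 'b \<Rightarrow> (nat \<Rightarrow> 'b) \<Rightarrow> nat \<Rightarrow> 'b" where
  "insert_row p a w = (\<lambda>q. if q < p then w q else if q = p then a else w (q - 1))"

lemma rdet_cong:
  assumes "\<And>i j. i < n \<Longrightarrow> j < n \<Longrightarrow> R i j = S i j"
  shows "rdet n R = rdet n S"
  using assms by (intro arg_cong[where f = det] eq_matI) auto

lemma rdet_identical_rows:
  assumes "i < n" "k < n" "i \<noteq> k" "\<And>j. j < n \<Longrightarrow> R i j = R k j"
  shows "rdet n R = 0"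
  by (rule det_identical_rows[of _ n i k]) (use assms in \<open>auto intro!: eq_vecI\<close>)

text \<open>
  Expanding along the inserted row separates that row from the others: moving the position only
  changes the sign, and what is left is a linear form in \<open>a\<close> with coefficients that depend on \<open>w\<close> alone.
\<close>

lemma rdet_insert_row:
  assumes "p < n"
  shows "rdet n (insert_row p a w) =
    (-1) ^ p * (\<Sum>j<n. a j * ((-1) ^ j * rdet (n - 1) (\<lambda>q c. w q (insert_index j c))))"
proof -
  let ?A = "mat n n (\<lambda>(i, j). insert_row p a w i j)"
  have "mat_delete ?A p j = mat (n - 1) (n - 1) (\<lambda>(q, c). w q (insert_index j c))"
    if "j < n" for j
    using that assms
    by (intro eq_matI) (auto simp: mat_delete_def insert_row_def insert_index_def)
  then have "?A $$ (p, j) * cofactor ?A p j =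
      (-1) ^ p * (a j * ((-1) ^ j * rdet (n - 1) (\<lambda>q c. w q (insert_index j c))))" if "j < n" for j
    using that assms by (simp add: cofactor_def insert_row_def power_add)
  then show ?thesis
    by (subst laplace_expansion_row[of _ n p]) (use assms in \<open>auto simp: sum_distrib_left\<close>)
qed

text \<open>
  The position \<open>p i\<close> at which \<open>u i\<close> enters the second factor is left open so that each
  determinant can be read off with its rows in the natural order. The relation is Cramer's rule:
  \<open>n + 1\<close> vectors of length \<open>n\<close> satisfy the linear relation whose coefficients are their signed
  maximal minors, and the second factor is linear in the vector \<open>u i\<close>.
\<close>

lemma plucker_relation:
  assumes "\<And>i. i \<le> n \<Longrightarrow> p i < n"
  shows "(\<Sum>i\<le>n. (-1) ^ (i + p i) * rdet n (\<lambda>q. u (insert_index i q)) * rdet n (insert_row (p i) (u i) w)) = 0"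
proof -
  define C where "C j = (-1) ^ j * rdet (n - 1) (\<lambda>q c. w q (insert_index j c))" for j
  have cramer: "(\<Sum>i\<le>n. (-1) ^ i * rdet n (\<lambda>q. u (insert_index i q)) * u i j) = 0" if "j < n" for j
  proof -
    let ?P = "mat (Suc n) (Suc n) (\<lambda>(i, c). u i (if c = 0 then j else c - 1))"
    have "mat_delete ?P i 0 = mat n n (\<lambda>(q, c). u (insert_index i q) c)" if "i \<le> n" for i
      using that by (intro eq_matI) (auto simp: mat_delete_def insert_index_def)
    then have expand: "det ?P = (\<Sum>i<Suc n. u i j * ((-1) ^ i * rdet n (\<lambda>q. u (insert_index i q))))"
      by (subst laplace_expansion_column[of _ "Suc n" 0]) (auto simp: cofactor_def)
    \<comment> \<open>Column \<open>j\<close> has been repeated in front, so the expansion along it must vanish.\<close>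
    have "det ?P = 0"
      by (rule det_identical_columns[of _ "Suc n" 0 "Suc j"]) (use that in \<open>auto intro!: eq_vecI\<close>)
    then show ?thesis
      unfolding expand by (simp add: lessThan_Suc_atMost mult_ac)
  qed
  have "(\<Sum>i\<le>n. (-1) ^ (i + p i) * rdet n (\<lambda>q. u (insert_index i q)) * rdet n (insert_row (p i) (u i) w))
      = (\<Sum>i\<le>n. \<Sum>j<n. (-1) ^ i * rdet n (\<lambda>q. u (insert_index i q)) * u i j * C j)"
  proof (rule sum.cong[OF refl])
    fix i assume "i \<in> {..n}"
    then have "rdet n (insert_row (p i) (u i) w) = (-1) ^ p i * (\<Sum>j<n. u i j * C j)"
      unfolding C_def using assms by (intro rdet_insert_row) auto
    then have "(-1) ^ (i + p i) * rdet n (\<lambda>q. u (insert_index i q)) * rdet n (insert_row (p i) (u i) w)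
      = ((-1) ^ p i * (-1) ^ p i) * ((-1) ^ i * rdet n (\<lambda>q. u (insert_index i q)) * (\<Sum>j<n. u i j * C j))"
      by (simp add: power_add mult_ac)
    then show "(-1) ^ (i + p i) * rdet n (\<lambda>q. u (insert_index i q)) * rdet n (insert_row (p i) (u i) w)
      = (\<Sum>j<n. (-1) ^ i * rdet n (\<lambda>q. u (insert_index i q)) * u i j * C j)"
      by (simp add: power_add[symmetric] sum_distrib_left mult.assoc flip: mult_2)
  qed
  also have "\<dots> = (\<Sum>j<n. (\<Sum>i\<le>n. (-1) ^ i * rdet n (\<lambda>q. u (insert_index i q)) * u i j) * C j)"
    by (subst sum.swap) (simp add: sum_distrib_right)
  finally show ?thesis
    using cramer by simp
qed


section \<open>Jacobi-Trudi determinants and their quadratic relation\<close>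

text \<open>
  The Jacobi-Trudi determinant with \<open>m\<close> rows.
\<close>

definition jt :: "(int \<Rightarrow> 'a::comm_ring_1) \<Rightarrow> nat \<Rightarrow> (nat \<Rightarrow> nat) \<Rightarrow> 'a" where
  "jt h m \<mu> = rdet m (\<lambda>i j. h (int (\<mu> i) - int i + int j))"

text \<open>
  For a weakly decreasing \<open>\<mu>\<close> and the first row \<open>r\<close> of a block of equal rows, these two operations
  produce \<open>\<lambda>\<^sup>+\<^sub>-(\<alpha>)\<close> and \<open>\<lambda>\<^sup>-\<^sub>+(\<alpha>)\<close> for the inner corner \<open>\<alpha>\<close> in row \<open>r\<close>.
\<close>

definition drop_row :: "nat \<Rightarrow> (nat \<Rightarrow> nat) \<Rightarrow> nat \<Rightarrow> nat" where
  "drop_row r \<mu> = (\<lambda>q. if q < r then \<mu> q + 1 else \<mu> (q + 1))"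

definition double_row :: "nat \<Rightarrow> (nat \<Rightarrow> nat) \<Rightarrow> nat \<Rightarrow> nat" where
  "double_row r \<mu> = (\<lambda>q. if q < r then \<mu> q - 1 else if q = r then \<mu> q else \<mu> (q - 1))"

lemma rdet_unit_first_row:
  assumes "\<And>j. R 0 j = of_bool (j = 0)"
  shows "rdet (Suc n) R = rdet n (\<lambda>i j. R (Suc i) (Suc j))"
proof -
  have "rdet (Suc n) R = rdet (Suc n) (insert_row 0 (R 0) (\<lambda>i. R (Suc i)))"
    by (rule rdet_cong) (auto simp: insert_row_def)
  also have "\<dots> = (\<Sum>j<Suc n. R 0 j * ((-1) ^ j * rdet n (\<lambda>i c. R (Suc i) (insert_index j c))))"
    by (subst rdet_insert_row) auto
  also have "\<dots> = (\<Sum>j<Suc n. if j = 0 then rdet n (\<lambda>i c. R (Suc i) (insert_index 0 c)) else 0)"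
    by (intro sum.cong) (auto simp: assms)
  finally show ?thesis
    by (simp add: insert_index_def)
qed

text \<open>
  The Pluecker relation for the vectors \<open>e, W (\<mu> 0), W (\<mu> 1 - 1), \<dots>, W (\<mu> (l + 1) - l - 1)\<close> and
  \<open>W (\<mu> 0 - 1), W (\<mu> 1 - 2), \<dots>, W (\<mu> l - l - 1)\<close>. By the equality of the last two rows both
  families end in the same vector, so exchanging it contributes nothing. In each minor that
  contains \<open>e\<close> the first column drops out, so that \<open>j\<close> becomes \<open>j + 1\<close>: this turns the rows \<open>W (\<mu>\<^sub>q - q)\<close>
  of the first family into those of \<open>\<mu>\<^sub>q + 1\<close>.
\<close>

lemma jt_square:
  assumes zero: "\<mu> l = \<mu> (Suc l)" and pos: "\<And>q. q < l \<Longrightarrow> \<mu> q > 0"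
  shows "jt h (l + 2) \<mu> * jt h (l + 1) \<mu> =
    (\<Sum>r\<le>l. jt h (l + 1) (drop_row r \<mu>) * jt h (l + 2) (double_row r \<mu>))"
proof -
  define W where "W c j = h (c + int j)" for c j
  define e where "e j = (of_bool (j = 0) :: 'a)" for j :: nat
  define u where "u i = (if i = 0 then e else W (int (\<mu> (i - 1)) - int (i - 1)))" for i
  define w where "w q = W (int (\<mu> q) - int q - 1)" for q
  \<comment> \<open>Inserting \<open>u (r + 1)\<close> at position \<open>r\<close> gives the row order of \<open>double_row r \<mu>\<close>, and every term but the first gets the sign -1.\<close>
  define p where "p i = (if i = 0 then 0 else i - 1)" for i :: nat
  define n where "n = l + 2"
  define t where "t i = (-1) ^ (i + p i) * rdet n (\<lambda>q. u (insert_index i q)) * rdet n (insert_row (p i) (u i) w)" for i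
  have "(\<Sum>i\<le>n. t i) = 0"
    unfolding t_def by (rule plucker_relation) (auto simp: p_def n_def)
  moreover have "(\<Sum>i\<le>n. t i) = t 0 + (\<Sum>r\<le>l. t (Suc r)) + t n"
    proof -
    have "(\<Sum>i\<le>n. t i) = (\<Sum>i\<le>Suc l. t i) + t n"
      by (simp add: n_def)
    also have "(\<Sum>i\<le>Suc l. t i) = t 0 + (\<Sum>r\<le>l. t (Suc r))"
      by (rule sum.atMost_Suc_shift)
    finally show ?thesis .
  qed
  \<comment> \<open>The last vector of \<open>u\<close> is also the last one of \<open>w\<close>.\<close>
  moreover have "t n = 0"
  proof -
    have "rdet n (insert_row (p n) (u n) w) = 0"
      by (rule rdet_identical_rows[of l _ "Suc l"])
        (auto simp: n_def p_def insert_row_def u_def w_def zero algebra_simps)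
    then show ?thesis by (simp add: t_def)
  qed
  moreover have "t 0 = jt h (l + 2) \<mu> * jt h (l + 1) \<mu>"
  proof -
    have 1: "rdet n (\<lambda>q. u (insert_index 0 q)) = jt h (l + 2) \<mu>"
      unfolding jt_def n_def by (rule rdet_cong) (auto simp: u_def W_def insert_index_def)
    have "rdet n (insert_row 0 e w) = jt h (l + 1) \<mu>"
      unfolding n_def jt_def numeral_2_eq_2 add_Suc_right add_0_right One_nat_def
    proof (subst rdet_unit_first_row)
      show "rdet (Suc l) (\<lambda>i j. insert_row 0 e w (Suc i) (Suc j)) =
          rdet (Suc l) (\<lambda>i j. h (int (\<mu> i) - int i + int j))"
        by (rule rdet_cong) (simp add: insert_row_def w_def W_def algebra_simps)
    qed (simp add: insert_row_def e_def)
    then show ?thesis using 1 by (simp add: t_def p_def u_def)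
  qed
  moreover have step: "t (Suc r) = - (jt h (l + 1) (drop_row r \<mu>) * jt h (l + 2) (double_row r \<mu>))"
    if r: "r \<le> l" for r
  proof -
    have 1: "rdet n (\<lambda>q. u (insert_index (Suc r) q)) = jt h (l + 1) (drop_row r \<mu>)"
      unfolding n_def jt_def numeral_2_eq_2 add_Suc_right add_0_right One_nat_def
    proof (subst rdet_unit_first_row)
      show "rdet (Suc l) (\<lambda>i j. u (insert_index (Suc r) (Suc i)) (Suc j)) =
          rdet (Suc l) (\<lambda>i j. h (int (drop_row r \<mu> i) - int i + int j))"
        by (rule rdet_cong) (simp add: insert_index_def u_def W_def drop_row_def algebra_simps)
    qed (simp add: insert_index_def u_def e_def)
    have 2: "rdet n (insert_row r (u (Suc r)) w) = jt h (l + 2) (double_row r \<mu>)"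
      unfolding jt_def n_def
    proof (rule rdet_cong)
      fix i j :: nat
      show "insert_row r (u (Suc r)) w i j = h (int (double_row r \<mu> i) - int i + int j)"
        using r pos[of i]
        by (auto simp: insert_row_def u_def w_def W_def double_row_def of_nat_diff Suc_le_eq algebra_simps)
    qed
    have "(-1) ^ (Suc r + r) = (-1 :: 'a)" by (subst neg_one_odd_power) auto
    then have "(-1) ^ (Suc r + p (Suc r)) = (-1 :: 'a)" by (simp only: p_def) simp
    then show ?thesis
      unfolding t_def using 1 2 by (simp add: p_def)
  qed
  moreover have "(\<Sum>r\<le>l. t (Suc r)) =
      - (\<Sum>r\<le>l. jt h (l + 1) (drop_row r \<mu>) * jt h (l + 2) (double_row r \<mu>))"
    unfolding sum_negf[symmetric] by (rule sum.cong) (use step in auto)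
  ultimately show ?thesis
    by simp
qed

lemma jt_double_row_eq_0:
  assumes "0 < r" "r < m" "\<mu> (r - 1) = \<mu> r" "0 < \<mu> r"
  shows "jt h m (double_row r \<mu>) = 0"
  unfolding jt_def
  by (rule rdet_identical_rows[of "r - 1" _ r])
    (use assms in \<open>auto simp: double_row_def of_nat_diff Suc_le_eq\<close>)

section \<open>The branching rule for Jacobi-Trudi determinants\<close>

text \<open>
  The shapes that remain when a horizontal strip is removed.
\<close>

definition interlaced :: "(nat \<Rightarrow> nat) \<Rightarrow> (nat \<Rightarrow> nat) set" where
  "interlaced \<mu> = {\<nu>. \<forall>i. \<mu> (Suc i) \<le> \<nu> i \<and> \<nu> i \<le> \<mu> i}"

lemma interlaced_antimono: "\<nu> \<in> interlaced \<mu> \<Longrightarrow> antimono \<nu>"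
  unfolding antimono_iff_le_Suc interlaced_def by (auto intro: order_trans)

lemma interlaced_eq_0: "\<nu> \<in> interlaced \<mu> \<Longrightarrow> \<mu> i = 0 \<Longrightarrow> \<nu> i = 0"
  unfolding interlaced_def by (drule CollectD, drule spec[of _ i]) simp

text \<open>
  The complete homogeneous symmetric polynomials in \<open>n\<close> variables. Degrees are integers because
  the Jacobi-Trudi matrix has entries of negative degree, which are 0.
\<close>

fun homog :: "(nat \<Rightarrow> 'a::comm_ring_1) \<Rightarrow> nat \<Rightarrow> int \<Rightarrow> 'a" where
  "homog x 0 c = of_bool (c = 0)"
| "homog x (Suc n) c = (\<Sum>k\<le>nat c. x n ^ k * homog x n (c - int k))"

lemma homog_neg: "c < 0 \<Longrightarrow> homog x n c = 0"
  by (induction n arbitrary: c) auto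

lemma homog_Suc: "homog x (Suc n) c = homog x n c + x n * homog x (Suc n) (c - 1)"
proof (cases "c > 0")
  case True
  define k where "k = nat (c - 1)"
  have c: "c = int (Suc k)" using True by (simp add: k_def)
  have "homog x (Suc n) c = (\<Sum>i\<le>Suc k. x n ^ i * homog x n (c - int i))"
    by (simp only: homog.simps c nat_int)
  also have "\<dots> = homog x n c + (\<Sum>i\<le>k. x n ^ Suc i * homog x n (c - int (Suc i)))"
    by (subst sum.atMost_Suc_shift) simp
  also have "(\<Sum>i\<le>k. x n ^ Suc i * homog x n (c - int (Suc i)))
      = x n * homog x (Suc n) (c - 1)"
    by (auto simp: c sum_distrib_left mult.assoc intro!: sum.cong)
  finally show ?thesis .
qed (auto simp: homog_neg)

lemma homog_telescope:
  "homog x (Suc n) (c + int k) - x n ^ Suc k * homog x (Suc n) (c - 1)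
    = (\<Sum>b\<le>k. x n ^ (k - b) * homog x n (c + int b))"
proof (induction k)
  case 0
  then show ?case by (simp only: homog_Suc[of x n "c + int 0"]) simp
next
  case (Suc k)
  have "homog x (Suc n) (c + int (Suc k)) - x n ^ Suc (Suc k) * homog x (Suc n) (c - 1)
      = homog x n (c + int (Suc k)) +
        x n * (homog x (Suc n) (c + int k) - x n ^ Suc k * homog x (Suc n) (c - 1))"
    by (subst homog_Suc) (simp add: algebra_simps)
  also have "\<dots> = (\<Sum>b\<le>Suc k. x n ^ (Suc k - b) * homog x n (c + int b))"
  proof -
    have "x n * (\<Sum>b\<le>k. x n ^ (k - b) * homog x n (c + int b)) =
        (\<Sum>b\<le>k. x n ^ (Suc k - b) * homog x n (c + int b))"
      unfolding sum_distrib_left by (rule sum.cong) (auto simp: Suc_diff_le mult.assoc)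
    then show ?thesis
      unfolding Suc.IH by simp
  qed
  finally show ?case .
qed

text \<open>
  The telescoping sum behind the branching rule: two entries from adjacent rows of a Jacobi-Trudi
  matrix combine to a sum over exactly the row lengths between \<open>a\<close> and \<open>b\<close>.
\<close>

lemma homog_difference:
  assumes "a \<le> b"
  shows "homog x (Suc n) (int b + d) - x n ^ Suc (b - a) * homog x (Suc n) (int a - 1 + d)
    = (\<Sum>c\<in>{a..b}. x n ^ (b - c) * homog x n (int c + d))"
proof -
  obtain k where b: "b = a + k" using assms le_Suc_ex by blast
  have "(\<Sum>c\<in>{a..b}. x n ^ (b - c) * homog x n (int c + d))
      = (\<Sum>i\<le>k. x n ^ (k - i) * homog x n (int a + d + int i))"
    unfolding b
    by (rule sum.reindex_bij_witness[of _ "\<lambda>i. a + i" "\<lambda>c. c - a"]) (auto simp: algebra_simps)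
  also have "\<dots> = homog x (Suc n) (int a + d + int k) - x n ^ Suc k * homog x (Suc n) (int a + d - 1)"
    by (rule homog_telescope[symmetric])
  finally show ?thesis
    by (simp add: b algebra_simps)
qed

lemma rdet_sum_rows:
  assumes "\<And>i. i < m \<Longrightarrow> finite (B i)"
  shows "rdet m (\<lambda>i j. \<Sum>b\<in>B i. f i b * R i b j) =
    (\<Sum>g\<in>Pi\<^sub>E {..<m} B. (\<Prod>i<m. f i (g i)) * rdet m (\<lambda>i j. R i (g i) j))"
proof -
  have lt: "p i < m" if "p permutes {0..<m}" "i < m" for p i
    using permutes_in_image[OF that(1), of i] that(2) by auto
  have "rdet m (\<lambda>i j. \<Sum>b\<in>B i. f i b * R i b j) =
      (\<Sum>p | p permutes {0..<m}. signof p * (\<Prod>i<m. \<Sum>b\<in>B i. f i b * R i b (p i)))"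
    by (subst det_def'[of _ m]) (auto simp: atLeast0LessThan lt intro!: sum.cong prod.cong)
  also have "\<dots> = (\<Sum>p | p permutes {0..<m}. \<Sum>g\<in>Pi\<^sub>E {..<m} B.
      (\<Prod>i<m. f i (g i)) * (signof p * (\<Prod>i<m. R i (g i) (p i))))"
    by (subst prod_sum_PiE) (auto simp: assms sum_distrib_left prod.distrib mult_ac)
  also have "\<dots> = (\<Sum>g\<in>Pi\<^sub>E {..<m} B. (\<Prod>i<m. f i (g i)) *
      (\<Sum>p | p permutes {0..<m}. signof p * (\<Prod>i<m. R i (g i) (p i))))"
    by (subst sum.swap) (simp add: sum_distrib_left)
  also have "\<dots> = (\<Sum>g\<in>Pi\<^sub>E {..<m} B. (\<Prod>i<m. f i (g i)) * rdet m (\<lambda>i j. R i (g i) j))"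
    by (subst det_def'[of _ m]) (auto simp: atLeast0LessThan lt intro!: sum.cong prod.cong)
  finally show ?thesis .
qed

text \<open>
  Subtracting \<open>x\<^sub>n\<^bsup>\<mu>\<^sub>i - \<mu>\<^sub>i\<^sub>+\<^sub>1 + 1\<^esup>\<close> times row \<open>i + 1\<close> from row \<open>i\<close> is multiplication by a unitriangular
  matrix and does not change the determinant. By \<open>homog_difference\<close> the new row \<open>i\<close> is a sum over
  \<open>\<mu>\<^sub>i\<^sub>+\<^sub>1 \<le> b \<le> \<mu>\<^sub>i\<close>, so that expanding all rows amounts to choosing an interlaced shape.
\<close>

lemma jt_branching:
  assumes anti: "antimono \<mu>" and zero: "\<And>i. i \<ge> m \<Longrightarrow> \<mu> i = 0"
  shows "jt (homog x (Suc n)) m \<mu> =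
    (\<Sum>\<nu>\<in>interlaced \<mu>. (\<Prod>i<m. x n ^ (\<mu> i - \<nu> i)) * jt (homog x n) m \<nu>)"
proof -
  let ?h = "homog x n" and ?h' = "homog x (Suc n)"
  let ?M = "mat m m (\<lambda>(i, j). ?h' (int (\<mu> i) - int i + int j))"
  define e where "e i = Suc (\<mu> i - \<mu> (Suc i))" for i
  let ?U = "mat m m (\<lambda>(i, k). if k = i then 1 else if k = Suc i then - (x n ^ e i) else 0)"
  have le: "\<mu> (Suc i) \<le> \<mu> i" for i using anti by (simp add: antimono_iff_le_Suc)
  have entry: "(?U * ?M) $$ (i, j) =
      (\<Sum>b\<in>{\<mu> (Suc i)..\<mu> i}. x n ^ (\<mu> i - b) * ?h (int b - int i + int j))"
    if i: "i < m" and j: "j < m" for i j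
  proof -
    have "(?U * ?M) $$ (i, j) = (\<Sum>k<m. (if k = i then 1 else if k = Suc i then - (x n ^ e i) else 0) *
        ?h' (int (\<mu> k) - int k + int j))"
      using that by (simp add: scalar_prod_def atLeast0LessThan)
    also have "\<dots> = (\<Sum>k<m. (if k = i then ?h' (int (\<mu> i) - int i + int j) else 0) -
        (if k = Suc i then x n ^ e i * ?h' (int (\<mu> (Suc i)) - int (Suc i) + int j) else 0))"
      by (intro sum.cong) auto
    also have "\<dots> = ?h' (int (\<mu> i) - int i + int j) -
        (if Suc i < m then x n ^ e i * ?h' (int (\<mu> (Suc i)) - int (Suc i) + int j) else 0)"
      unfolding sum_subtractf using i by (simp del: homog.simps)
    also have "(if Suc i < m then x n ^ e i * ?h' (int (\<mu> (Suc i)) - int (Suc i) + int j) else 0) =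
        x n ^ e i * ?h' (int (\<mu> (Suc i)) - 1 + (int j - int i))"
    \<comment> \<open>The last row has no successor, but the row that would follow it vanishes anyway: its degrees are negative.\<close>
    proof (cases "Suc i < m")
      case False
      then have "?h' (int (\<mu> (Suc i)) - 1 + (int j - int i)) = 0"
        using i j zero[of "Suc i"] by (intro homog_neg) auto
      then show ?thesis using False by (simp del: homog.simps)
    qed (simp add: algebra_simps del: homog.simps)
    finally show ?thesis
      using homog_difference[OF le[of i], of x n "int j - int i"]
      by (simp add: e_def algebra_simps del: homog.simps)
  qed
  have "det ?U = 1"
    by (subst det_upper_triangular[of _ m]) (auto simp: prod_list_diag_prod)
  then have "jt ?h' m \<mu> = det (?U * ?M)"
    unfolding jt_def by (subst det_mult[of _ m]) auto
  also have "?U * ?M = mat m m (\<lambda>(i, j).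
      \<Sum>b\<in>{\<mu> (Suc i)..\<mu> i}. x n ^ (\<mu> i - b) * ?h (int b - int i + int j))"
    by (rule eq_matI) (use entry in auto)
  also have "det \<dots> = (\<Sum>g\<in>Pi\<^sub>E {..<m} (\<lambda>i. {\<mu> (Suc i)..\<mu> i}).
      (\<Prod>i<m. x n ^ (\<mu> i - g i)) * jt ?h m g)"
    unfolding jt_def by (rule rdet_sum_rows[where R = "\<lambda>i b j. homog x n (int b - int i + int j)"]) auto
  also have "\<dots> = (\<Sum>\<nu>\<in>interlaced \<mu>. (\<Prod>i<m. x n ^ (\<mu> i - \<nu> i)) * jt ?h m \<nu>)"
  proof (rule sum.reindex_bij_witness[of _ "\<lambda>\<nu>. restrict \<nu> {..<m}" "\<lambda>g i. if i < m then g i else 0"])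
    fix \<nu> assume \<nu>: "\<nu> \<in> interlaced \<mu>"
    then show "(\<lambda>i. if i < m then restrict \<nu> {..<m} i else 0) = \<nu>"
      using interlaced_eq_0[OF \<nu>] zero by (auto simp: fun_eq_iff)
    show "restrict \<nu> {..<m} \<in> Pi\<^sub>E {..<m} (\<lambda>i. {\<mu> (Suc i)..\<mu> i})"
      using \<nu> by (auto simp: interlaced_def)
  next
    fix g assume g: "g \<in> Pi\<^sub>E {..<m} (\<lambda>i. {\<mu> (Suc i)..\<mu> i})"
    then show "restrict (\<lambda>i. if i < m then g i else 0) {..<m} = g"
      by (auto simp: fun_eq_iff PiE_def extensional_def)
    show "(\<lambda>i. if i < m then g i else 0) \<in> interlaced \<mu>"
      using g zero by (auto simp: interlaced_def PiE_iff)
    show "(\<Prod>i<m. x n ^ (\<mu> i - (if i < m then g i else 0))) * jt ?h m (\<lambda>i. if i < m then g i else 0)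
      = (\<Prod>i<m. x n ^ (\<mu> i - g i)) * jt ?h m g"
      unfolding jt_def by (intro arg_cong2[where f = "(*)"] rdet_cong prod.cong) auto
  qed
  finally show ?thesis .
qed

lemma jt_no_variables:
  assumes anti: "antimono \<mu>" and zero: "\<And>i. i \<ge> m \<Longrightarrow> \<mu> i = 0"
  shows "jt (homog x 0) m \<mu> = of_bool (\<mu> = (\<lambda>_. 0))"
proof (cases "\<mu> 0 = 0")
  case True
  then have "\<mu> = (\<lambda>_. 0)"
    using antimonoD[OF anti, of 0] by (auto simp: fun_eq_iff)
  moreover have "mat m m (\<lambda>(i, j). homog x 0 (int 0 - int i + int j)) = 1\<^sub>m m"
    by (rule eq_matI) auto
  ultimately show ?thesis
    unfolding jt_def by simp
next
  case False
  then have "m > 0" using zero[of 0] by (cases m) auto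
  then have "jt (homog x 0) m \<mu> = 0"
    unfolding jt_def using False
    by (subst laplace_expansion_row[of _ m 0]) auto
  then show ?thesis using False by auto
qed

section \<open>Schur polynomials and the Jacobi-Trudi formula\<close>

definition cells :: "(nat \<Rightarrow> nat) \<Rightarrow> (nat \<times> nat) set" where
  "cells \<mu> = {(r, c). c < \<mu> r}"

definition tableaux :: "nat \<Rightarrow> (nat \<times> nat) set \<Rightarrow> (nat \<times> nat \<Rightarrow> nat) set" where
  "tableaux n D = {T \<in> D \<rightarrow>\<^sub>E {..<n}.
     (\<forall>r c c'. c < c' \<longrightarrow> (r, c) \<in> D \<longrightarrow> (r, c') \<in> D \<longrightarrow> T (r, c) \<le> T (r, c')) \<and>
     (\<forall>r r' c. r < r' \<longrightarrow> (r, c) \<in> D \<longrightarrow> (r', c) \<in> D \<longrightarrow> T (r, c) < T (r', c))}"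

definition schur_poly :: "(nat \<Rightarrow> 'a::comm_ring_1) \<Rightarrow> nat \<Rightarrow> (nat \<times> nat) set \<Rightarrow> 'a" where
  "schur_poly x n D = (\<Sum>T\<in>tableaux n D. \<Prod>p\<in>D. x (T p))"

lemma cells_diff:
  assumes "\<And>i. i \<ge> m \<Longrightarrow> \<mu> i = 0"
  shows "cells \<mu> - cells \<nu> = (SIGMA i:{..<m}. {\<nu> i..<\<mu> i})"
proof -
  have "i < m" if "c < \<mu> i" for c i
    using that assms[of i] by (cases "i < m") auto
  then show ?thesis by (auto simp: cells_def)
qed

lemma finite_cells:
  assumes "\<And>i. i \<ge> m \<Longrightarrow> \<mu> i = 0"
  shows "finite (cells \<mu>)"
proof -
  have "cells \<mu> = cells \<mu> - cells (\<lambda>_. 0)" by (auto simp: cells_def)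
  then show ?thesis by (simp add: cells_diff[OF assms])
qed

lemma down_closed_eq_lessThan:
  assumes "\<And>c c'. c' \<in> A \<Longrightarrow> c \<le> c' \<Longrightarrow> c \<in> A" "finite (A :: nat set)"
  shows "A = {..<card A}"
proof -
  obtain k where "k \<notin> A" using ex_new_if_finite[OF infinite_UNIV_nat assms(2)] by blast
  define b where "b = (LEAST k. k \<notin> A)"
  have "b \<notin> A" unfolding b_def by (rule LeastI) fact
  moreover have "c \<in> A" if "c < b" for c using not_less_Least that unfolding b_def by blast
  ultimately have "A = {..<b}" using assms(1) by (auto simp flip: not_le)
  then show ?thesis by simp
qed

text \<open>
  The cells of a tableau with entry below \<open>n\<close> form a shape \<open>\<nu>\<close>. It interlaces \<open>\<mu>\<close>: a cell that has another
  one below it carries an entry smaller than \<open>n\<close> by column strictness. Conversely, a tableau of an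
  interlaced shape extends uniquely by writing \<open>n\<close> into all other cells, no two of which lie
  in the same column.
\<close>

lemma schur_poly_branching:
  fixes x :: "nat \<Rightarrow> 'a::comm_ring_1"
  assumes anti: "antimono \<mu>" and zero: "\<And>i. i \<ge> m \<Longrightarrow> \<mu> i = 0"
  shows "schur_poly x (Suc n) (cells \<mu>) =
    (\<Sum>\<nu>\<in>interlaced \<mu>. (\<Prod>i<m. x n ^ (\<mu> i - \<nu> i)) * schur_poly x n (cells \<nu>))"
proof -
  define inner where "inner T r = card {c. c < \<mu> r \<and> T (r, c) < n}" for T r
  define extend where
    "extend \<nu> S p = (if p \<in> cells \<nu> then S p else if p \<in> cells \<mu> then n else undefined)"
    for \<nu> and S :: "nat \<times> nat \<Rightarrow> nat" and p
  have sub: "cells \<nu> \<subseteq> cells \<mu>" if "\<nu> \<in> interlaced \<mu>" for \<nu>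
    using that by (auto simp: cells_def interlaced_def intro: less_le_trans)
  have fin: "finite (cells \<mu>)" by (rule finite_cells[OF zero])
  have fin_int: "finite (interlaced \<mu>)"
  proof (rule finite_subset)
    show "interlaced \<mu> \<subseteq> {\<nu>. \<forall>i. (i \<in> {..<m} \<longrightarrow> \<nu> i \<in> {..\<mu> 0}) \<and> (i \<notin> {..<m} \<longrightarrow> \<nu> i = 0)}"
      using zero antimonoD[OF anti, of 0] interlaced_eq_0
      by (auto simp: interlaced_def intro: order_trans)
    show "finite \<dots>" by (intro finite_set_of_finite_funs) auto
  qed
  have fin_tab: "finite (tableaux n (cells \<nu>))" if "\<nu> \<in> interlaced \<mu>" for \<nu>
    unfolding tableaux_def
    by (rule finite_subset[of _ "cells \<nu> \<rightarrow>\<^sub>E {..<n}"])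
      (use finite_subset[OF sub[OF that] fin] in \<open>auto intro: finite_PiE\<close>)
  have weight: "(\<Prod>p\<in>cells \<mu>. x (extend \<nu> S p)) =
      (\<Prod>i<m. x n ^ (\<mu> i - \<nu> i)) * (\<Prod>p\<in>cells \<nu>. x (S p))" if \<nu>: "\<nu> \<in> interlaced \<mu>" for \<nu> S
  proof -
    have "(\<Prod>p\<in>cells \<mu> - cells \<nu>. x (extend \<nu> S p)) = (\<Prod>p\<in>cells \<mu> - cells \<nu>. x n)"
      by (rule prod.cong) (auto simp: extend_def)
    also have "\<dots> = x n ^ (\<Sum>i<m. \<mu> i - \<nu> i)"
      by (simp add: cells_diff[OF zero])
    also have "\<dots> = (\<Prod>i<m. x n ^ (\<mu> i - \<nu> i))"
      by (rule power_sum)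
    moreover have "(\<Prod>p\<in>cells \<nu>. x (extend \<nu> S p)) = (\<Prod>p\<in>cells \<nu>. x (S p))"
      by (rule prod.cong) (auto simp: extend_def)
    ultimately show ?thesis
      by (simp add: prod.subset_diff[OF sub[OF \<nu>] fin])
  qed
  have inner_iff: "(r, c) \<in> cells (inner T) \<longleftrightarrow> (r, c) \<in> cells \<mu> \<and> T (r, c) < n"
    if T: "T \<in> tableaux (Suc n) (cells \<mu>)" for T r c
  proof -
    have "{c. c < \<mu> r \<and> T (r, c) < n} = {..<card {c. c < \<mu> r \<and> T (r, c) < n}}"
    proof (rule down_closed_eq_lessThan)
      fix c c' assume "c' \<in> {c. c < \<mu> r \<and> T (r, c) < n}" "c \<le> c'"
      moreover have "T (r, c) \<le> T (r, c')" if "c < c'" "c' < \<mu> r"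
        using T that by (auto simp: tableaux_def cells_def)
      ultimately show "c \<in> {c. c < \<mu> r \<and> T (r, c) < n}"
        by (cases "c = c'") (auto simp: le_less intro: le_less_trans)
    qed simp
    then show ?thesis
      unfolding inner_def cells_def by blast
  qed
  have inner: "inner T \<in> interlaced \<mu>" if T: "T \<in> tableaux (Suc n) (cells \<mu>)" for T
    unfolding interlaced_def
  proof (intro CollectI allI conjI)
    fix r
    have "c < inner T r" if c: "c < \<mu> (Suc r)" for c
    proof -
      have c': "c < \<mu> r" using c antimonoD[OF anti, of r "Suc r"] by simp
      have "T (r, c) < T (Suc r, c)" "T (Suc r, c) < Suc n"
        using T c c' by (auto simp: tableaux_def cells_def PiE_iff)
      then show ?thesis using inner_iff[OF T, of r c] c' by (simp add: cells_def)
    qed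
    then show "\<mu> (Suc r) \<le> inner T r" using not_le by blast
    have "inner T r \<le> card {..<\<mu> r}" unfolding inner_def by (rule card_mono) auto
    then show "inner T r \<le> \<mu> r" by simp
  qed
  have "schur_poly x (Suc n) (cells \<mu>) =
      (\<Sum>(\<nu>, S)\<in>(SIGMA \<nu>:interlaced \<mu>. tableaux n (cells \<nu>)). \<Prod>p\<in>cells \<mu>. x (extend \<nu> S p))"
    unfolding schur_poly_def
  proof (rule sum.reindex_bij_witness[of _ "\<lambda>(\<nu>, S). extend \<nu> S" "\<lambda>T. (inner T, restrict T (cells (inner T)))"])
    fix T assume T: "T \<in> tableaux (Suc n) (cells \<mu>)"
    have ext: "extend (inner T) (restrict T (cells (inner T))) p = T p" for p
    proof (cases "p \<in> cells \<mu>")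
      case True
      then have "T p < Suc n" using T by (auto simp: tableaux_def)
      then show ?thesis
        using True inner_iff[OF T, of "fst p" "snd p"] by (auto simp: extend_def less_Suc_eq)
    next
      case False
      then have "T p = undefined" using T by (auto simp: tableaux_def intro: PiE_arb)
      then show ?thesis
        using False inner_iff[OF T, of "fst p" "snd p"] by (simp add: extend_def)
    qed
    then show "(case (inner T, restrict T (cells (inner T))) of (\<nu>, S) \<Rightarrow> extend \<nu> S) = T"
      by (auto simp: fun_eq_iff)
    show "(inner T, restrict T (cells (inner T))) \<in> (SIGMA \<nu>:interlaced \<mu>. tableaux n (cells \<nu>))"
      using T inner[OF T] by (auto simp: inner_iff[OF T] tableaux_def)
    show "(case (inner T, restrict T (cells (inner T))) of (\<nu>, S) \<Rightarrow> \<Prod>p\<in>cells \<mu>. x (extend \<nu> S p))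
      = (\<Prod>p\<in>cells \<mu>. x (T p))"
      by (simp add: ext)
  next
    fix a assume a: "a \<in> (SIGMA \<nu>:interlaced \<mu>. tableaux n (cells \<nu>))"
    obtain \<nu> S where a_eq: "a = (\<nu>, S)" by (cases a)
    have \<nu>: "\<nu> \<in> interlaced \<mu>" and S: "S \<in> tableaux n (cells \<nu>)" using a a_eq by auto
    have lt: "S p < n" if "p \<in> cells \<nu>" for p
      using S that by (auto simp: tableaux_def PiE_iff)
    have above: "(r, c) \<in> cells \<nu>" if "r < r'" "(r', c) \<in> cells \<mu>" for r r' c
    proof -
      have "\<mu> r' \<le> \<mu> (Suc r)" using antimonoD[OF anti] that by simp
      also have "\<dots> \<le> \<nu> r" using \<nu> by (simp add: interlaced_def)
      finally show ?thesis using that by (simp add: cells_def)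
    qed
    have E: "extend \<nu> S \<in> tableaux (Suc n) (cells \<mu>)"
      unfolding tableaux_def
    proof (intro CollectI conjI allI impI)
      show "extend \<nu> S \<in> cells \<mu> \<rightarrow>\<^sub>E {..<Suc n}"
        using sub[OF \<nu>] by (auto simp: extend_def less_Suc_eq lt)
    next
      fix r c c' :: nat assume "c < c'" "(r, c) \<in> cells \<mu>" "(r, c') \<in> cells \<mu>"
      moreover have "(r, c') \<in> cells \<nu> \<Longrightarrow> (r, c) \<in> cells \<nu> \<and> S (r, c) \<le> S (r, c')"
        using S \<open>c < c'\<close> by (auto simp: tableaux_def cells_def)
      ultimately show "extend \<nu> S (r, c) \<le> extend \<nu> S (r, c')"
        by (auto simp: extend_def less_imp_le lt)
    next
      fix r r' c :: nat assume "r < r'" "(r, c) \<in> cells \<mu>" "(r', c) \<in> cells \<mu>"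
      moreover have "(r', c) \<in> cells \<nu> \<Longrightarrow> S (r, c) < S (r', c)"
        using S \<open>r < r'\<close> above[OF \<open>r < r'\<close> \<open>(r', c) \<in> cells \<mu>\<close>] by (auto simp: tableaux_def)
      ultimately show "extend \<nu> S (r, c) < extend \<nu> S (r', c)"
        using above[OF \<open>r < r'\<close>] by (auto simp: extend_def lt)
    qed
    then show "(case a of (\<nu>, S) \<Rightarrow> extend \<nu> S) \<in> tableaux (Suc n) (cells \<mu>)"
      by (simp add: a_eq)
    have cells_eq: "cells (inner (extend \<nu> S)) = cells \<nu>"
    proof (rule Set.set_eqI)
      fix p :: "nat \<times> nat"
      obtain r c where p: "p = (r, c)" by (cases p)
      show "p \<in> cells (inner (extend \<nu> S)) \<longleftrightarrow> p \<in> cells \<nu>"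
        using inner_iff[OF E, of r c] sub[OF \<nu>] lt[of "(r, c)"] unfolding p
        by (cases "(r, c) \<in> cells \<nu>") (auto simp: extend_def)
    qed
    have inner_eq: "inner (extend \<nu> S) = \<nu>"
    proof
      fix r
      have "c < inner (extend \<nu> S) r \<longleftrightarrow> c < \<nu> r" for c
      proof -
        have "(r, c) \<in> cells (inner (extend \<nu> S)) \<longleftrightarrow> (r, c) \<in> cells \<nu>"
          by (simp only: cells_eq)
        then show ?thesis by (simp add: cells_def)
      qed
      from this[of "inner (extend \<nu> S) r"] this[of "\<nu> r"]
      show "inner (extend \<nu> S) r = \<nu> r" by simp
    qed
    have "restrict (extend \<nu> S) (cells \<nu>) = S"
    proof
      fix p
      show "restrict (extend \<nu> S) (cells \<nu>) p = S p"
        using S by (cases "p \<in> cells \<nu>") (auto simp: extend_def tableaux_def dest: PiE_arb)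
    qed
    then show "(inner (case a of (\<nu>, S) \<Rightarrow> extend \<nu> S),
        restrict (case a of (\<nu>, S) \<Rightarrow> extend \<nu> S) (cells (inner (case a of (\<nu>, S) \<Rightarrow> extend \<nu> S)))) = a"
      by (simp add: a_eq inner_eq)
  qed
  also have "\<dots> = (\<Sum>\<nu>\<in>interlaced \<mu>. \<Sum>S\<in>tableaux n (cells \<nu>). \<Prod>p\<in>cells \<mu>. x (extend \<nu> S p))"
    by (rule sum.Sigma[OF fin_int ballI[OF fin_tab], symmetric])
  also have "\<dots> = (\<Sum>\<nu>\<in>interlaced \<mu>. (\<Prod>i<m. x n ^ (\<mu> i - \<nu> i)) * schur_poly x n (cells \<nu>))"
    by (intro sum.cong) (auto simp: weight schur_poly_def sum_distrib_left)
  finally show ?thesis .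
qed

lemma schur_poly_no_variables: "schur_poly x 0 (cells \<mu>) = of_bool (\<mu> = (\<lambda>_. 0))"
proof (cases "\<mu> = (\<lambda>_. 0)")
  case True
  then have "cells \<mu> = {}" by (simp add: cells_def)
  then show ?thesis using True by (simp add: schur_poly_def tableaux_def)
next
  case False
  then obtain r where "\<mu> r \<noteq> 0" by (auto simp: fun_eq_iff)
  then have "(r, 0) \<in> cells \<mu>" by (simp add: cells_def)
  then have "tableaux 0 (cells \<mu>) = {}" by (auto simp: tableaux_def)
  then show ?thesis using False by (simp add: schur_poly_def)
qed

text \<open>
  Both sides obey the same recursion in the number of variables and agree when there are none.
  The number \<open>m\<close> of rows is free, because zero rows may be added; this freedom is what makes
  \<open>jt_square\<close> a statement about squares.
\<close>

theorem jacobi_trudi: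
  assumes "antimono \<mu>" and "\<And>i. i \<ge> m \<Longrightarrow> \<mu> i = 0"
  shows "schur_poly x n (cells \<mu>) = jt (homog x n) m \<mu>"
  using assms
proof (induction n arbitrary: \<mu>)
  case 0
  then show ?case unfolding schur_poly_no_variables by (rule jt_no_variables[symmetric])
next
  case (Suc n)
  have "schur_poly x n (cells \<nu>) = jt (homog x n) m \<nu>" if "\<nu> \<in> interlaced \<mu>" for \<nu>
    using interlaced_antimono[OF that] interlaced_eq_0[OF that] Suc.prems(2)
    by (intro Suc.IH) auto
  then have "(\<Sum>\<nu>\<in>interlaced \<mu>. (\<Prod>i<m. x n ^ (\<mu> i - \<nu> i)) * schur_poly x n (cells \<nu>)) =
      (\<Sum>\<nu>\<in>interlaced \<mu>. (\<Prod>i<m. x n ^ (\<mu> i - \<nu> i)) * jt (homog x n) m \<nu>)"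
    by (intro sum.cong) auto
  then show ?case
    using schur_poly_branching[of \<mu> m x n] jt_branching[of \<mu> m x n] Suc.prems by presburger
qed

section \<open>The square of a Schur polynomial\<close>

lemma antimono_drop_row: "antimono \<mu> \<Longrightarrow> antimono (drop_row r \<mu>)"
  unfolding antimono_iff_le_Suc
proof
  fix q assume "\<forall>n. \<mu> (Suc n) \<le> \<mu> n"
  then have "\<mu> (Suc q) \<le> \<mu> q" "\<mu> (Suc (Suc q)) \<le> \<mu> (Suc q)" by blast+
  then show "drop_row r \<mu> (Suc q) \<le> drop_row r \<mu> q" by (auto simp: drop_row_def)
qed

text \<open>
  At a row that starts no block the operation can fail to give a partition: the row above is
  shortened below the length of the next one.
\<close>

lemma antimono_double_row:
  assumes "antimono \<mu>" and corner: "r = 0 \<or> \<mu> r < \<mu> (r - 1)"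
  shows "antimono (double_row r \<mu>)"
  unfolding antimono_iff_le_Suc
proof
  fix q
  have "\<mu> (Suc q) \<le> \<mu> q" "\<mu> q \<le> \<mu> (q - 1)" using antimonoD[OF assms(1)] by simp_all
  then show "double_row r \<mu> (Suc q) \<le> double_row r \<mu> q"
    using corner by (cases "Suc q" r rule: linorder_cases) (auto simp: double_row_def)
qed

text \<open>
  The rows in which an inner corner lies, the row just below the diagram included.
\<close>

definition corner_rows :: "nat \<Rightarrow> (nat \<Rightarrow> nat) \<Rightarrow> nat set" where
  "corner_rows l \<mu> = {r. r \<le> l \<and> (r = 0 \<or> \<mu> r < \<mu> (r - 1))}"

theorem schur_poly_square:
  assumes anti: "antimono \<mu>" and pos: "\<And>q. q < l \<Longrightarrow> \<mu> q > 0" and zero: "\<And>q. q \<ge> l \<Longrightarrow> \<mu> q = 0"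
  shows "schur_poly x n (cells \<mu>) * schur_poly x n (cells \<mu>) =
    (\<Sum>r\<in>corner_rows l \<mu>. schur_poly x n (cells (drop_row r \<mu>)) * schur_poly x n (cells (double_row r \<mu>)))"
proof -
  let ?h = "homog x n"
  have "schur_poly x n (cells \<mu>) = jt ?h (l + 2) \<mu>"
    by (rule jacobi_trudi[OF anti]) (simp add: zero)
  moreover have "schur_poly x n (cells \<mu>) = jt ?h (l + 1) \<mu>"
    by (rule jacobi_trudi[OF anti]) (simp add: zero)
  ultimately have "schur_poly x n (cells \<mu>) * schur_poly x n (cells \<mu>) =
      (\<Sum>r\<le>l. jt ?h (l + 1) (drop_row r \<mu>) * jt ?h (l + 2) (double_row r \<mu>))"
    using jt_square[of \<mu> l ?h] pos zero by simp
  also have "\<dots> = (\<Sum>r\<in>corner_rows l \<mu>. jt ?h (l + 1) (drop_row r \<mu>) * jt ?h (l + 2) (double_row r \<mu>))"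
  proof (rule sum.mono_neutral_right)
    show "\<forall>r\<in>{..l} - corner_rows l \<mu>. jt ?h (l + 1) (drop_row r \<mu>) * jt ?h (l + 2) (double_row r \<mu>) = 0"
    proof
      fix r assume "r \<in> {..l} - corner_rows l \<mu>"
      then have r: "0 < r" "r \<le> l" "\<mu> (r - 1) \<le> \<mu> r" by (auto simp: corner_rows_def)
      then have "\<mu> (r - 1) = \<mu> r" "0 < \<mu> (r - 1)"
        using antimonoD[OF anti, of "r - 1" r] pos[of "r - 1"] by simp_all
      then have "jt ?h (l + 2) (double_row r \<mu>) = 0"
        using r by (intro jt_double_row_eq_0) auto
      then show "jt ?h (l + 1) (drop_row r \<mu>) * jt ?h (l + 2) (double_row r \<mu>) = 0" by simp
    qed
  qed (auto simp: corner_rows_def)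
  also have "\<dots> = (\<Sum>r\<in>corner_rows l \<mu>.
      schur_poly x n (cells (drop_row r \<mu>)) * schur_poly x n (cells (double_row r \<mu>)))"
  proof (rule sum.cong[OF refl])
    fix r assume r: "r \<in> corner_rows l \<mu>"
    have "schur_poly x n (cells (drop_row r \<mu>)) = jt ?h (l + 1) (drop_row r \<mu>)"
      by (rule jacobi_trudi[OF antimono_drop_row[OF anti]])
        (use r in \<open>auto simp: drop_row_def corner_rows_def zero\<close>)
    moreover have "schur_poly x n (cells (double_row r \<mu>)) = jt ?h (l + 2) (double_row r \<mu>)"
      by (rule jacobi_trudi[OF antimono_double_row[OF anti]])
        (use r in \<open>auto simp: double_row_def corner_rows_def zero\<close>)
    ultimately show "jt ?h (l + 1) (drop_row r \<mu>) * jt ?h (l + 2) (double_row r \<mu>) =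
      schur_poly x n (cells (drop_row r \<mu>)) * schur_poly x n (cells (double_row r \<mu>))" by simp
  qed
  finally show ?thesis .
qed


section \<open>Schur functions as power series\<close>

definition mono_fps :: "(nat \<Rightarrow>\<^sub>0 nat) \<Rightarrow> int mfps" where
  "mono_fps a = Abs_mfps (\<lambda>\<mu>. of_bool (\<mu> = a))"

definition var_fps :: "nat \<Rightarrow> int mfps" where
  "var_fps v = mono_fps (Poly_Mapping.single v 1)"

lemma mcoeff_sum: "mcoeff (sum f A) \<mu> = (\<Sum>a\<in>A. mcoeff (f a) \<mu>)"
  by (induction A rule: infinite_finite_induct) (auto simp: zero_mfps_def plus_mfps_def)

lemma mcoeff_mult: "mcoeff (f * g) \<mu> = (\<Sum>(\<alpha>, \<beta>)\<in>splits \<mu>. mcoeff f \<alpha> * mcoeff g \<beta>)"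
  by (simp add: times_mfps_def)

lemma mono_fps_mult: "mono_fps a * mono_fps b = mono_fps (a + b)"
proof (rule mfps_eqI)
  fix \<mu>
  have "mcoeff (mono_fps a * mono_fps b) \<mu> = (\<Sum>p\<in>splits \<mu>. if p = (a, b) then 1 else 0)"
    unfolding mcoeff_mult by (rule sum.cong) (auto simp: mono_fps_def)
  also have "\<dots> = mcoeff (mono_fps (a + b)) \<mu>"
    by (subst sum.delta[OF finite_splits]) (auto simp: splits_def mono_fps_def)
  finally show "mcoeff (mono_fps a * mono_fps b) \<mu> = mcoeff (mono_fps (a + b)) \<mu>" .
qed

lemma prod_var_fps:
  "finite A \<Longrightarrow> (\<Prod>p\<in>A. var_fps (T p)) = mono_fps (\<Sum>p\<in>A. Poly_Mapping.single (T p) 1)"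
  by (induction A rule: finite_induct)
    (auto simp: var_fps_def mono_fps_mult, simp add: mono_fps_def one_mfps_def of_bool_def)

lemma lookup_sum_single:
  "finite A \<Longrightarrow> Poly_Mapping.lookup (\<Sum>p\<in>A. Poly_Mapping.single (T p) 1) v = card {p \<in> A. T p = v}"
proof (induction A rule: finite_induct)
  case (insert a A)
  have "{p \<in> insert a A. T p = v} = (if T a = v then insert a {p \<in> A. T p = v} else {p \<in> A. T p = v})"
    by auto
  then show ?case
    using insert by (auto simp: lookup_add lookup_single when_def)
qed simp

text \<open>
  A tableau whose content is the exponent vector \<open>\<mu>\<close> only has entries in the support of \<open>\<mu>\<close>, so
  that the variables outside of it do not influence the coefficient.
\<close>

lemma mcoeff_schur:
  assumes "Poly_Mapping.keys \<mu> \<subseteq> {..<n}"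
  shows "mcoeff (schur lam) \<mu> = mcoeff (schur_poly var_fps n (diagram lam)) \<mu>"
proof -
  let ?D = "diagram lam"
  have content: "\<mu> = (\<Sum>p\<in>?D. Poly_Mapping.single (T p) 1) \<longleftrightarrow>
      Defs.content lam T = Poly_Mapping.lookup \<mu>" for T
  proof -
    have "Poly_Mapping.lookup (\<Sum>p\<in>?D. Poly_Mapping.single (T p) 1) = Defs.content lam T"
      by (rule ext) (simp only: lookup_sum_single[OF finite_diagram] Defs.content_def)
    then show ?thesis
      unfolding lookup_inject[symmetric] by auto
  qed
  have "tableaux n ?D \<subseteq> ?D \<rightarrow>\<^sub>E {..<n}" by (auto simp: tableaux_def)
  then have fin: "finite (tableaux n ?D)" by (rule finite_subset) (auto intro: finite_PiE)
  have bound: "T p < n" if "Defs.content lam T = Poly_Mapping.lookup \<mu>" "p \<in> ?D" for T p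
  proof -
    have "Defs.content lam T (T p) \<noteq> 0"
      using that(2) by (cases p) (auto simp: Defs.content_def card_eq_0_iff)
    then have "T p \<in> Poly_Mapping.keys \<mu>" using that(1) by (simp add: in_keys_iff)
    then show ?thesis using assms by auto
  qed
  have "mcoeff (schur_poly var_fps n ?D) \<mu> =
      (\<Sum>T\<in>tableaux n ?D. of_bool (Defs.content lam T = Poly_Mapping.lookup \<mu>))"
    unfolding schur_poly_def mcoeff_sum
    by (rule sum.cong) (simp_all only: prod_var_fps finite_diagram mono_fps_def mcoeff_Abs content)
  also have "\<dots> = int (card {T \<in> tableaux n ?D. Defs.content lam T = Poly_Mapping.lookup \<mu>})"
    using fin by (simp add: of_bool_def sum.If_cases Int_def)
  also have "{T \<in> tableaux n ?D. Defs.content lam T = Poly_Mapping.lookup \<mu>} =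
      {T \<in> ssyt lam. Defs.content lam T = Poly_Mapping.lookup \<mu>}"
    unfolding tableaux_def ssyt_def using bound by (auto simp: PiE_iff)
  finally show ?thesis
    by (simp add: schur_def)
qed

lemma mcoeff_schur_mult:
  assumes "Poly_Mapping.keys \<mu> \<subseteq> {..<n}"
  shows "mcoeff (schur lam * schur lam') \<mu> =
    mcoeff (schur_poly var_fps n (diagram lam) * schur_poly var_fps n (diagram lam')) \<mu>"
  unfolding mcoeff_mult
proof (rule sum.cong[OF refl], clarify)
  fix \<alpha> \<beta> assume "(\<alpha>, \<beta>) \<in> splits \<mu>"
  then have "Poly_Mapping.keys \<alpha> \<subseteq> {..<n}" "Poly_Mapping.keys \<beta> \<subseteq> {..<n}"
    using assms by (auto simp: splits_def in_keys_iff lookup_add subset_iff)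
  then show "mcoeff (schur lam) \<alpha> * mcoeff (schur lam') \<beta> =
    mcoeff (schur_poly var_fps n (diagram lam)) \<alpha> * mcoeff (schur_poly var_fps n (diagram lam')) \<beta>"
    by (simp add: mcoeff_schur)
qed


section \<open>Partitions as lists and their inner corners\<close>

text \<open>
  Row lengths of a list, continued by 0; they determine the diagram, and they do not see trailing zeros.
\<close>

definition row_len :: "nat list \<Rightarrow> nat \<Rightarrow> nat" where
  "row_len L r = (if r < length L then L ! r else 0)"

lemma diagram_eq_cells: "diagram L = cells (row_len L)"
  by (auto simp: diagram_def cells_def row_len_def split: if_splits)

lemma antimono_row_len: "sorted_wrt (\<ge>) L \<Longrightarrow> antimono (row_len L)"
  unfolding antimono_iff_le_Suc row_len_def by (auto simp: sorted_wrt_iff_nth_less)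

text \<open>
  In a weakly decreasing list the zeros are at the end, so dropping them leaves the diagram as it is.
\<close>

lemma row_len_filter:
  "antimono (row_len L) \<Longrightarrow> row_len (filter (\<lambda>x. x \<noteq> 0) L) = row_len L"
proof (induction L)
  case (Cons a L)
  have shift: "row_len (b # K) = (\<lambda>r. case r of 0 \<Rightarrow> b | Suc q \<Rightarrow> row_len K q)" for b K
    by (auto simp: row_len_def fun_eq_iff split: nat.split)
  have "antimono (row_len L)"
    unfolding antimono_iff_le_Suc
  proof
    fix q
    show "row_len L (Suc q) \<le> row_len L q"
      using antimonoD[OF Cons.prems, of "Suc q" "Suc (Suc q)"] by (simp add: shift)
  qed
  then have IH: "row_len (filter (\<lambda>x. x \<noteq> 0) L) = row_len L" by (rule Cons.IH)
  show ?case
  proof (cases "a = 0")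
    case True
    have "row_len L q = 0" for q
      using antimonoD[OF Cons.prems, of 0 "Suc q"] True by (simp add: shift)
    then show ?thesis using True IH by (auto simp: shift fun_eq_iff split: nat.split)
  next
    case False
    then have "filter (\<lambda>x. x \<noteq> 0) (a # L) = a # filter (\<lambda>x. x \<noteq> 0) L" by simp
    then show ?thesis by (simp only: shift IH)
  qed
qed simp

text \<open>
  With the list cut above row \<open>r\<close>, the two shape operations act separately on the rows above and on the
  rest. The part \<open>take 1 Q\<close> is the repeated row, and it is absent if \<open>r\<close> lies below the diagram.
\<close>

lemma row_len_drop_row: "row_len (map Suc P @ tl Q) = drop_row (length P) (row_len (P @ Q))"
  by (auto simp: row_len_def drop_row_def fun_eq_iff nth_append nth_tl Suc_diff_le)

lemma row_len_double_row:
  "row_len (map (\<lambda>x. x - 1) P @ take 1 Q @ Q) = double_row (length P) (row_len (P @ Q))"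
proof
  fix q
  show "row_len (map (\<lambda>x. x - 1) P @ take 1 Q @ Q) q = double_row (length P) (row_len (P @ Q)) q"
  proof (cases Q)
    case Nil
    then show ?thesis by (auto simp: row_len_def double_row_def nth_append)
  next
    case (Cons a R)
    show ?thesis
    proof (cases "q \<le> length P")
      case True
      then show ?thesis by (auto simp: Cons row_len_def double_row_def nth_append)
    next
      case False
      then obtain d where "q = Suc (length P + d)" 
        using less_imp_Suc_add[of "length P" q] by auto
      then show ?thesis by (simp add: Cons row_len_def double_row_def nth_append)
    qed
  qed
qed

definition block :: "nat list \<Rightarrow> nat \<Rightarrow> nat list" where
  "block lam j = replicate (Defs.mult lam j) (part lam j)"

text \<open>
  In a sorted list equal entries are adjacent, so it is the concatenation of its constant blocks.
\<close>

lemma concat_replicate_remdups: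
  "sorted_wrt (\<ge>) (xs :: nat list) \<Longrightarrow>
    concat (map (\<lambda>x. replicate (count_list xs x) x) (remdups xs)) = xs"
proof (induction xs)
  case (Cons x xs)
  let ?f = "\<lambda>xs x. replicate (count_list xs x) x"
  have IH: "concat (map (?f xs) (remdups xs)) = xs" using Cons by simp
  show ?case
  proof (cases "x \<in> set xs")
    case False
    have "map (?f (x # xs)) (remdups xs) = map (?f xs) (remdups xs)"
      using False by (intro map_cong) auto
    moreover have "?f (x # xs) x = [x]" using False by (simp add: count_notin)
    moreover have "remdups (x # xs) = x # remdups xs" using False by simp
    ultimately show ?thesis by (simp only: list.map concat.simps IH append.simps)
  next
    case True
    then obtain y ys where xs: "xs = y # ys" by (cases xs) auto
    have "x = y" using True Cons.prems xs by (auto intro: antisym)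
    obtain z zs where zs: "remdups xs = z # zs" using True by (cases "remdups xs") auto
    have "z \<in> set xs" using zs by (metis list.set_intros(1) set_remdups)
    then have "count_list xs z \<noteq> 0" by (simp add: count_list_0_iff)
    then have "z = y" using IH unfolding zs by (cases "count_list xs z") (auto simp: xs)
    have "z \<notin> set zs" using distinct_remdups[of xs] unfolding zs by simp
    then have "map (?f (x # xs)) zs = map (?f xs) zs"
      using \<open>x = y\<close> \<open>z = y\<close> by (intro map_cong) auto
    moreover have "?f (x # xs) z = x # ?f xs z" using \<open>x = y\<close> \<open>z = y\<close> by simp
    moreover have "remdups (x # xs) = z # zs" using True zs by simp
    moreover have "?f xs z @ concat (map (?f xs) zs) = xs" using IH unfolding zs by simp
    ultimately show ?thesis by (simp only: list.map concat.simps append.simps)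
  qed
qed simp

lemma concat_blocks:
  assumes "is_partition lam"
  shows "concat (map (block lam) [1..<num_parts lam + 1]) = lam"
proof -
  have "map (block lam) [1..<num_parts lam + 1] =
      map (\<lambda>x. replicate (count_list lam x) x) (remdups lam)"
    by (rule nth_equalityI) 
      (simp_all add: num_parts_def block_def Defs.mult_def Defs.part_def del: upt_Suc)
  then show ?thesis
    using concat_replicate_remdups assms by (simp add: is_partition_def)
qed

definition corner_row :: "nat list \<Rightarrow> nat \<Rightarrow> nat" where
  "corner_row lam i = (\<Sum>j = 1..<i. Defs.mult lam j)"

lemma length_blocks: "length (concat (map (block lam) [1..<i])) = corner_row lam i"
  by (simp add: length_concat block_def corner_row_def o_def sum_list_distinct_conv_sum_set)

lemma corner_row_Suc: "1 \<le> i \<Longrightarrow> corner_row lam (Suc i) = corner_row lam i + Defs.mult lam i"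
  by (simp add: corner_row_def)

lemma corner_row_mono: "i \<le> j \<Longrightarrow> corner_row lam i \<le> corner_row lam j"
  unfolding corner_row_def by (rule sum_mono2) auto

lemma part_in_set:
  assumes "1 \<le> i" "i \<le> num_parts lam"
  shows "part lam i \<in> set lam"
  using nth_mem[of "i - 1" "remdups lam"] assms by (simp add: Defs.part_def num_parts_def)

lemma mult_pos: "1 \<le> i \<Longrightarrow> i \<le> num_parts lam \<Longrightarrow> 0 < Defs.mult lam i"
  using part_in_set[of i lam] by (simp add: Defs.mult_def count_list_0_iff flip: neq0_conv)

lemma corner_row_strict_mono:
  assumes "1 \<le> i" "i < j" "j \<le> num_parts lam + 1"
  shows "corner_row lam i < corner_row lam j"
proof -
  have "corner_row lam i < corner_row lam (Suc i)"
    using mult_pos[of i lam] assms by (simp add: corner_row_Suc)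
  also have "\<dots> \<le> corner_row lam j" by (rule corner_row_mono) (use assms in simp)
  finally show ?thesis .
qed

lemma part_neq_part_Suc:
  assumes "is_partition lam" "1 \<le> i" "i \<le> num_parts lam"
  shows "part lam i \<noteq> part lam (Suc i)"
proof (cases "Suc i \<le> num_parts lam")
  case True
  then have "remdups lam ! (i - 1) \<noteq> remdups lam ! i"
    using assms by (subst nth_eq_iff_index_eq) (auto simp: num_parts_def)
  then show ?thesis using True assms by (simp add: Defs.part_def)
next
  case False
  then have "part lam (Suc i) = 0" by (simp add: Defs.part_def)
  moreover have "part lam i \<noteq> 0"
    using part_in_set[OF assms(2,3)] assms(1) unfolding is_partition_def by metis
  ultimately show ?thesis by simp
qed

lemma blocks_split:
  assumes "is_partition lam" "1 \<le> i" "i \<le> num_parts lam + 1"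
  shows "lam = concat (map (block lam) [1..<i]) @ concat (map (block lam) [i..<num_parts lam + 1])"
proof -
  have "[1..<num_parts lam + 1] = [1..<i] @ [i..<num_parts lam + 1]"
    using upt_add_eq_append[of 1 i "num_parts lam + 1 - i"] assms by simp
  then show ?thesis using concat_blocks[OF assms(1)] by (metis concat_append map_append)
qed

lemma corner_row_last: "is_partition lam \<Longrightarrow> corner_row lam (num_parts lam + 1) = length lam"
  using concat_blocks[of lam] length_blocks[of lam "num_parts lam + 1"] by simp

lemma row_len_block:
  assumes "is_partition lam" "1 \<le> i" "i \<le> num_parts lam"
    and "corner_row lam i \<le> q" "q < corner_row lam (Suc i)"
  shows "row_len lam q = part lam i"
proof -
  let ?P = "concat (map (block lam) [1..<i])" and ?R = "concat (map (block lam) [Suc i..<num_parts lam + 1])"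
  have lam: "lam = ?P @ block lam i @ ?R"
    using blocks_split[of lam i] assms by (simp add: upt_conv_Cons del: upt_Suc)
  have q: "q < length (?P @ block lam i)"
    using assms by (simp add: length_blocks[unfolded One_nat_def] corner_row_Suc block_def)
  have "row_len (?P @ block lam i @ ?R) q = part lam i"
    using q assms(4,5) length_blocks[of lam i] corner_row_Suc[OF assms(2), of lam]
    by (simp add: row_len_def nth_append block_def less_diff_conv2 del: upt_Suc)
  then show ?thesis using lam by simp
qed

lemma row_len_corner_row:
  assumes "is_partition lam" "1 \<le> i" "i \<le> num_parts lam + 1"
  shows "row_len lam (corner_row lam i) = part lam i"
proof (cases "i \<le> num_parts lam")
  case True
  then show ?thesis using assms mult_pos[of i lam] by (intro row_len_block) (auto simp: corner_row_Suc)
next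
  case False
  then have "i = num_parts lam + 1" using assms by simp
  then show ?thesis using corner_row_last[OF assms(1)] by (simp add: row_len_def Defs.part_def)
qed

text \<open>
  A row that starts an inner corner is the first of its block, where the row length drops from one part
  to the next. Conversely, a row that is not the first of its block follows a row of the same block and
  thus of the same length.
\<close>

lemma corner_row_image:
  assumes lam: "is_partition lam"
  shows "corner_row lam ` {1..num_parts lam + 1} = corner_rows (length lam) (row_len lam)"
proof (intro subset_antisym subsetI)
  fix r assume "r \<in> corner_row lam ` {1..num_parts lam + 1}"
  then obtain i where i: "1 \<le> i" "i \<le> num_parts lam + 1" and r: "r = corner_row lam i" by auto
  have "r \<le> length lam"
    using corner_row_mono[OF i(2), of lam] corner_row_last[OF lam] r by simp
  moreover have "row_len lam r < row_len lam (r - 1)" if "r \<noteq> 0"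
  proof -
    have "i \<noteq> 1" using that r by (auto simp: corner_row_def)
    then obtain k where k: "i = Suc k" "1 \<le> k" "k \<le> num_parts lam"
      using i by (cases i) auto
    have "corner_row lam k < r" unfolding r by (rule corner_row_strict_mono) (use k i in auto)
    then have "row_len lam (r - 1) = part lam k"
      using r k that by (intro row_len_block[OF lam]) auto
    moreover have "row_len lam r = part lam (Suc k)"
      unfolding r k(1) using i k by (intro row_len_corner_row[OF lam]) auto
    moreover have "row_len lam r \<le> row_len lam (r - 1)"
      using lam by (intro antimonoD[OF antimono_row_len]) (auto simp: is_partition_def)
    ultimately show ?thesis
      using part_neq_part_Suc[OF lam k(2,3)] by simp
  qed
  ultimately show "r \<in> corner_rows (length lam) (row_len lam)"
    unfolding corner_rows_def by blast
next
  fix r assume r: "r \<in> corner_rows (length lam) (row_len lam)"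
  let ?I = "{i. 1 \<le> i \<and> i \<le> num_parts lam + 1 \<and> corner_row lam i \<le> r}"
  \<comment> \<open>The block that contains row \<open>r\<close>.\<close>
  define i where "i = Max ?I"
  have fin: "finite ?I" by (rule finite_subset[of _ "{..num_parts lam + 1}"]) auto
  have "1 \<in> ?I" by (simp add: corner_row_def)
  then have "i \<in> ?I" unfolding i_def using fin by (intro Max_in) auto
  then have i: "1 \<le> i" "i \<le> num_parts lam + 1" "corner_row lam i \<le> r" by auto
  have "corner_row lam i = r"
  proof (rule ccontr)
    assume "corner_row lam i \<noteq> r"
    then have lt: "corner_row lam i < r" using i by simp
    have "i \<noteq> num_parts lam + 1"
      using lt r corner_row_last[OF lam] by (auto simp: corner_rows_def)
    then have ik: "i \<le> num_parts lam" using i by simp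
    have "Suc i \<notin> ?I" using Max_ge[OF fin, of "Suc i"] unfolding i_def[symmetric] by linarith
    then have "r < corner_row lam (Suc i)" using ik by simp
    then have "row_len lam r = part lam i" "row_len lam (r - 1) = part lam i"
      using lt i ik by (auto intro!: row_len_block[OF lam])
    then show False using r lt by (auto simp: corner_rows_def)
  qed
  then show "r \<in> corner_row lam ` {1..num_parts lam + 1}" using i by auto
qed

lemma inj_on_corner_row: "inj_on (corner_row lam) {1..num_parts lam + 1}"
proof (rule linorder_inj_onI)
  fix i j assume "i < j" "i \<in> {1..num_parts lam + 1}" "j \<in> {1..num_parts lam + 1}"
  then show "corner_row lam i \<noteq> corner_row lam j"
    using corner_row_strict_mono[of i j lam] by auto
qed auto

text \<open>
  Cut \<open>lam\<close> above its \<open>i\<close>-th block. The blocks above are widened, and the \<open>i\<close>-th one loses a copy of its part, as if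
  its first row were deleted.
\<close>

lemma diagram_shift_pm:
  assumes lam: "is_partition lam" and i: "1 \<le> i" "i \<le> num_parts lam + 1"
  shows "diagram (shift_pm lam (corner lam i)) = cells (drop_row (corner_row lam i) (row_len lam))"
proof -
  let ?P = "concat (map (block lam) [1..<i])" and ?Q = "concat (map (block lam) [i..<num_parts lam + 1])"
  let ?g = "\<lambda>j. replicate (if j = i then Defs.mult lam j - 1 else Defs.mult lam j)
                           (if j < i then part lam j + 1 else part lam j)"
  have split: "[1..<num_parts lam + 1] = [1..<i] @ [i..<num_parts lam + 1]"
    using upt_add_eq_append[of 1 i "num_parts lam + 1 - i"] i by simp
  have "concat (map ?g [1..<i]) = map Suc ?P"
    unfolding map_concat map_map by (intro arg_cong[where f = concat] map_cong) (auto simp: block_def)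
  moreover have "concat (map ?g [i..<num_parts lam + 1]) = tl ?Q"
  proof (cases "i = num_parts lam + 1")
    case False
    let ?R = "[Suc i..<num_parts lam + 1]"
    have upt: "[i..<num_parts lam + 1] = i # ?R"
      using False i by (intro upt_conv_Cons) simp
    have pos: "0 < Defs.mult lam i" using False i by (intro mult_pos) auto
    have "concat (map ?g (i # ?R)) = ?g i @ concat (map ?g ?R)"
      by (simp only: list.map concat.simps)
    also have "map ?g ?R = map (block lam) ?R"
      by (intro map_cong) (auto simp: block_def)
    also have "?g i = tl (block lam i)"
      by (simp add: block_def)
    also have "tl (block lam i) @ concat (map (block lam) ?R) = tl (concat (map (block lam) (i # ?R)))"
      using pos by (simp add: block_def tl_append2 del: upt_Suc)
    finally show ?thesis unfolding upt .
  qed simp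
  ultimately have "shift_pm lam (corner lam i) = filter (\<lambda>x. x \<noteq> 0) (map Suc ?P @ tl ?Q)"
    unfolding shift_pm_corner[OF lam i] split map_append concat_append by simp
  moreover have rows: "row_len (map Suc ?P @ tl ?Q) = drop_row (corner_row lam i) (row_len lam)"
    unfolding row_len_drop_row length_blocks blocks_split[OF lam i, symmetric] ..
  moreover have "antimono \<dots>"
    using lam by (intro antimono_drop_row antimono_row_len) (simp add: is_partition_def)
  ultimately show ?thesis
    by (simp only: diagram_eq_cells row_len_filter)
qed

text \<open>
  Here the zeros that are dropped may come from parts 1 in the blocks above. The resulting list is still
  weakly decreasing, as the cut is at a corner: the last row above it exceeds the next part
  by at least one.
\<close>

lemma diagram_shift_mp:
  assumes lam: "is_partition lam" and i: "1 \<le> i" "i \<le> num_parts lam + 1"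
  shows "diagram (shift_mp lam (corner lam i)) = cells (double_row (corner_row lam i) (row_len lam))"
proof -
  let ?P = "concat (map (block lam) [1..<i])" and ?Q = "concat (map (block lam) [i..<num_parts lam + 1])"
  let ?g = "\<lambda>j. replicate (if j = i then Defs.mult lam j + 1 else Defs.mult lam j)
                           (if j < i then part lam j - 1 else part lam j)"
  have split: "[1..<num_parts lam + 1] = [1..<i] @ [i..<num_parts lam + 1]"
    using upt_add_eq_append[of 1 i "num_parts lam + 1 - i"] i by simp
  have "concat (map ?g [1..<i]) = map (\<lambda>x. x - 1) ?P"
    unfolding map_concat map_map by (intro arg_cong[where f = concat] map_cong) (auto simp: block_def)
  moreover have "concat (map ?g [i..<num_parts lam + 1]) = take 1 ?Q @ ?Q"
  proof (cases "i = num_parts lam + 1")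
    case False
    let ?R = "[Suc i..<num_parts lam + 1]"
    have upt: "[i..<num_parts lam + 1] = i # ?R"
      using False i by (intro upt_conv_Cons) simp
    have pos: "0 < Defs.mult lam i" using False i by (intro mult_pos) auto
    have "concat (map ?g (i # ?R)) = ?g i @ concat (map ?g ?R)"
      by (simp only: list.map concat.simps)
    also have "map ?g ?R = map (block lam) ?R"
      by (intro map_cong) (auto simp: block_def)
    also have "?g i = [part lam i] @ block lam i"
      by (simp add: block_def)
    also have "[part lam i] = take 1 (concat (map (block lam) (i # ?R)))"
      using pos by (cases "Defs.mult lam i") (simp_all add: block_def del: upt_Suc)
    finally show ?thesis unfolding upt by (simp only: list.map concat.simps append_assoc)
  qed simp
  ultimately have "shift_mp lam (corner lam i) =
      filter (\<lambda>x. x \<noteq> 0) (map (\<lambda>x. x - 1) ?P @ take 1 ?Q @ ?Q)"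
    unfolding shift_mp_corner[OF lam i] split map_append concat_append by simp
  moreover have rows: "row_len (map (\<lambda>x. x - 1) ?P @ take 1 ?Q @ ?Q) =
      double_row (corner_row lam i) (row_len lam)"
    unfolding row_len_double_row length_blocks blocks_split[OF lam i, symmetric] ..
  moreover have "antimono \<dots>"
  proof (rule antimono_double_row)
    show "antimono (row_len lam)" using lam by (intro antimono_row_len) (simp add: is_partition_def)
    have "corner_row lam i \<in> corner_rows (length lam) (row_len lam)"
      using corner_row_image[OF lam] i by auto
    then show "corner_row lam i = 0 \<or> row_len lam (corner_row lam i) < row_len lam (corner_row lam i - 1)"
      by (simp add: corner_rows_def)
  qed
  ultimately show ?thesis
    by (simp only: diagram_eq_cells row_len_filter)
qed

theorem corollary7:
  fixes lam :: "nat list"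
  assumes "is_partition lam"
  shows "schur lam * schur lam =
    (\<Sum>\<alpha>\<in>inner_corners lam. schur (shift_pm lam \<alpha>) * schur (shift_mp lam \<alpha>))"
proof (rule mfps_eqI)
  fix \<mu> :: "nat \<Rightarrow>\<^sub>0 nat"
  obtain n where n: "Poly_Mapping.keys \<mu> \<subseteq> {..<n}"
    using finite_nat_bounded[OF finite_keys[of \<mu>]] by auto
  let ?s = "\<lambda>D. schur_poly var_fps n D"
  let ?k = "num_parts lam + 1"
  have "?s (diagram lam) * ?s (diagram lam) =
      (\<Sum>r\<in>corner_rows (length lam) (row_len lam).
        ?s (cells (drop_row r (row_len lam))) * ?s (cells (double_row r (row_len lam))))"
    unfolding diagram_eq_cells
  proof (rule schur_poly_square)
    show "antimono (row_len lam)"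
      using assms by (intro antimono_row_len) (simp add: is_partition_def)
    show "0 < row_len lam q" if "q < length lam" for q
    proof -
      have "lam ! q \<noteq> 0" using nth_mem[OF that] assms unfolding is_partition_def by metis
      then show ?thesis using that by (simp add: row_len_def)
    qed
  qed (simp add: row_len_def)
  also have "\<dots> = (\<Sum>i\<in>{1..?k}. ?s (cells (drop_row (corner_row lam i) (row_len lam))) *
      ?s (cells (double_row (corner_row lam i) (row_len lam))))"
    unfolding corner_row_image[OF assms, symmetric] by (simp only: sum.reindex[OF inj_on_corner_row] o_def)
  also have "\<dots> = (\<Sum>i\<in>{1..?k}. ?s (diagram (shift_pm lam (corner lam i))) *
      ?s (diagram (shift_mp lam (corner lam i))))"
  proof (rule sum.cong[OF refl])
    fix i assume "i \<in> {1..?k}"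
    then have "1 \<le> i" "i \<le> ?k" by simp_all
    then show "?s (cells (drop_row (corner_row lam i) (row_len lam))) *
        ?s (cells (double_row (corner_row lam i) (row_len lam))) =
        ?s (diagram (shift_pm lam (corner lam i))) * ?s (diagram (shift_mp lam (corner lam i)))"
      by (simp only: diagram_shift_pm[OF assms] diagram_shift_mp[OF assms])
  qed
  also have "\<dots> = (\<Sum>\<alpha>\<in>inner_corners lam. ?s (diagram (shift_pm lam \<alpha>)) * ?s (diagram (shift_mp lam \<alpha>)))"
    unfolding inner_corners_def by (simp only: sum.reindex[OF inj_on_corner[OF assms]] o_def)
  finally show "mcoeff (schur lam * schur lam) \<mu> =
      mcoeff (\<Sum>\<alpha>\<in>inner_corners lam. schur (shift_pm lam \<alpha>) * schur (shift_mp lam \<alpha>)) \<mu>"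
    by (simp only: mcoeff_sum mcoeff_schur_mult[OF n])
qed

end
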